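(* Let $\Gamma$ be a countable discrete group. If $\Gamma$ is exact, then every weak limit of finite invariant random equivalence relations on $\Gamma$ is amenable; that is, if $(\rho_n)_{n\in\mathbb N}$ is a sequence of finite IREs on $\Gamma$ converging weakly to an IRE $\rho$, then $\rho$ is an amenable IRE.
   Context: Let $\Gamma$ be a countable discrete group. $\operatorname{Prob}(\Gamma)$ is the set of probability measures on $\Gamma$ with the topology (and Borel structure) inherited from $\ell^1(\Gamma)$; $\Gamma$ acts on it by $(g.\eta)(h)=\eta(g^{-1}h)$. Exactness: an action of $\Gamma$ by homeomorphisms on a topological space $X$ is topologically amenable if there are continuous maps $\eta_n\colon X\to \operatorname{Prob}(\Gamma)$, $x\mapsto \eta_n^x$ ($n\in\mathbb N$), such that for each $g\in\Gamma$, $\sup_{x\in X}\|g.\eta_n^x-\eta_n^{g.x}\|_1\to 0$ as $n\to\infty$. $\Gamma$ is exact if it admits a topologically amenable action on a (nonempty) compact metrizable space. Invariant random equivalence relations: $\mathcal E$ is the set of equivalence relations on $\Gamma$, with the topology inherited from $\{0,1\}^{\Gamma\times\Gamma}$ (a compact metrizable space). $\Gamma$ acts on $\mathcal E$ by left shift: $(h,h')\in g.r$ iff $(g^{-1}h,g^{-1}h')\in r$. For $r\in\mathcal E$, $[g]_r$ is the $r$-class of $g$; $e$ is the identity. An invariant random equivalence relation (IRE) on $\Gamma$ is a $\Gamma$-invariant Borel probability measure on $\mathcal E$. An IRE $\rho$ is finite if $\rho$-almost every $r$ has only finite classes. An IRE $\rho$ is amenable if there are Borel maps $\lambda_n\colon\mathcal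 E\to\operatorname{Prob}(\Gamma)$, $r\mapsto\lambda_n^r$ ($n\in\mathbb N$), such that for $\rho$-almost every $r\in\mathcal E$ and every $g\in[e]_r$, $\|g^{-1}.\lambda_n^r-\lambda_n^{g^{-1}.r}\|_1\to0$ as $n\to\infty$. Weak convergence refers to the weak topology on $\operatorname{Prob}(\mathcal E)$ (testing against continuous functions on $\mathcal E$). *)

theory Defs
  imports "HOL-Probability.Probability"
begin

text \<open>
  The group \<open>\<Gamma>\<close> is a countable type of class \<^class>\<open>group_add\<close>. That class is not assumed
  commutative; the group is written additively, so \<open>e\<close> is \<open>0\<close>, \<open>gh\<close> is \<open>g + h\<close> and the inverse
  of \<open>g\<close> is \<open>- g\<close>.

  Elements of \<open>Prob(\<Gamma>)\<close> are probability mass functions, metrised by the \<open>\<ell>\<^sup>1\<close> distance; the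
  type class operations \<open>open\<close> and \<open>borel\<close> on \<open>'g pmf\<close> below therefore refer to the structure
  inherited from \<open>\<ell>\<^sup>1(\<Gamma>)\<close>.
\<close>

instantiation pmf :: (type) metric_space
begin

definition dist_pmf :: "'a pmf \<Rightarrow> 'a pmf \<Rightarrow> real" where
  "dist_pmf p q = (\<Sum>\<^sub>\<infinity>h. \<bar>pmf p h - pmf q h\<bar>)"

definition uniformity_pmf :: "('a pmf \<times> 'a pmf) filter" where
  "uniformity_pmf = (INF e\<in>{0<..}. principal {(p, q). dist p q < e})"

definition open_pmf :: "'a pmf set \<Rightarrow> bool" where
  "open_pmf U \<longleftrightarrow> (\<forall>p\<in>U. \<forall>\<^sub>F (p', q) in uniformity. p' = p \<longrightarrow> q \<in> U)"

instance
proof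
  have diff: "(\<lambda>h. \<bar>pmf p h - pmf q h\<bar>) summable_on UNIV" for p q :: "'a pmf"
  proof -
    have s: "pmf r summable_on UNIV" for r :: "'a pmf"
      by (rule summable_on_iff_abs_summable_on_real[THEN iffD2,
          OF abs_summable_equivalent[THEN iffD2, OF pmf_abs_summable]])
    have "(\<lambda>h. pmf p h - pmf q h) summable_on UNIV"
      using summable_on_add[OF s[of p] summable_on_uminus[THEN iffD2, OF s[of q]]] by simp
    from summable_on_iff_abs_summable_on_real[THEN iffD1, OF this] show ?thesis
      by simp
  qed
  fix p q r :: "'a pmf"
  show "dist p q = 0 \<longleftrightarrow> p = q"
  proof
    assume "dist p q = 0"
    then have "\<bar>pmf p h - pmf q h\<bar> = 0" for h
      unfolding dist_pmf_def
      by (intro nonneg_infsum_le_0D[where A = UNIV] diff) auto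
    then show "p = q"
      by (intro pmf_eqI) simp
  qed (simp add: dist_pmf_def)
  have "dist p q \<le> (\<Sum>\<^sub>\<infinity>h. \<bar>pmf p h - pmf r h\<bar> + \<bar>pmf q h - pmf r h\<bar>)"
    unfolding dist_pmf_def by (intro infsum_mono diff summable_on_add) auto
  also have "\<dots> = dist p r + dist q r"
    unfolding dist_pmf_def by (intro infsum_add diff)
  finally show "dist p q \<le> dist p r + dist q r" .
qed (simp_all add: uniformity_pmf_def open_pmf_def)

end

definition pmf_shift :: "'g::group_add \<Rightarrow> 'g pmf \<Rightarrow> 'g pmf" where
  "pmf_shift g \<eta> = map_pmf (\<lambda>h. g + h) \<eta>"

lemma pmf_pmf_shift: "pmf (pmf_shift g \<eta>) h = pmf \<eta> (- g + h)"
  using pmf_map_inj'[of "(+) g" \<eta> "- g + h"]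
  by (simp add: pmf_shift_def add.assoc[symmetric])

definition homeo_action :: "'x topology \<Rightarrow> ('g::group_add \<Rightarrow> 'x \<Rightarrow> 'x) \<Rightarrow> bool" where
  "homeo_action X act \<longleftrightarrow>
     (\<forall>g. homeomorphic_map X X (act g)) \<and>
     (\<forall>x\<in>topspace X. act 0 x = x) \<and>
     (\<forall>g h. \<forall>x\<in>topspace X. act (g + h) x = act g (act h x))"

text \<open>
  The real supremum below is over a set bounded by 2; it has its intended meaning whenever the
  space is nonempty, which the definition of exactness requires.
\<close>

definition topologically_amenable_action ::
    "'x topology \<Rightarrow> ('g::group_add \<Rightarrow> 'x \<Rightarrow> 'x) \<Rightarrow> bool" where
  "topologically_amenable_action X act \<longleftrightarrow>
     homeo_action X act \<and>
     (\<exists>\<eta> :: nat \<Rightarrow> 'x \<Rightarrow> 'g pmf.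
        (\<forall>n. continuous_map X euclidean (\<eta> n)) \<and>
        (\<forall>g. (\<lambda>n. SUP x\<in>topspace X. dist (pmf_shift g (\<eta> n x)) (\<eta> n (act g x))) \<longlonglongrightarrow> 0))"

text \<open>
  HOL cannot quantify over types inside a formula, so the type of points of the space is a
  parameter. A group is exact iff this holds for some type \<open>'x\<close>; in particular, a theorem
  assuming \<open>exact_group TYPE('g) TYPE('x)\<close> with \<open>'x\<close> a type variable covers every space.
\<close>

definition exact_group :: "'g::group_add itself \<Rightarrow> 'x itself \<Rightarrow> bool" where
  "exact_group _ _ \<longleftrightarrow>
     (\<exists>(X :: 'x topology) (act :: 'g \<Rightarrow> 'x \<Rightarrow> 'x).
        compact_space X \<and> metrizable_space X \<and> topspace X \<noteq> {} \<and>
        topologically_amenable_action X act)"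

text \<open>
  A relation is a curried function into \<^typ>\<open>bool\<close>, which carries the discrete topology; the
  topology of \<^typ>\<open>'g \<Rightarrow> 'g \<Rightarrow> bool\<close> is the (iterated) product topology, that is, the one of
  \<open>{0,1}\<^bsup>\<Gamma>\<times>\<Gamma>\<^esup>\<close>.
\<close>

definition equivalences :: "('g \<Rightarrow> 'g \<Rightarrow> bool) set" where
  "equivalences = {r. equivp r}"

definition equivalences_borel :: "('g \<Rightarrow> 'g \<Rightarrow> bool) measure" where
  "equivalences_borel = restrict_space borel equivalences"

definition rel_shift :: "'g::group_add \<Rightarrow> ('g \<Rightarrow> 'g \<Rightarrow> bool) \<Rightarrow> ('g \<Rightarrow> 'g \<Rightarrow> bool)" where
  "rel_shift g r = (\<lambda>h h'. r (- g + h) (- g + h'))"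

lemma rel_shift_equivalences: "r \<in> equivalences \<Longrightarrow> rel_shift g r \<in> equivalences"
  unfolding equivalences_def rel_shift_def mem_Collect_eq
  by (intro equivpI reflpI sympI transpI) (auto elim: equivp_reflp equivp_symp equivp_transp)

lemma rel_shift_measurable: "rel_shift g \<in> equivalences_borel \<rightarrow>\<^sub>M equivalences_borel"
proof -
  have "continuous_on UNIV (\<lambda>r :: 'a \<Rightarrow> 'a \<Rightarrow> bool. r a b)" for a b
    by (rule continuous_on_product_then_coordinatewise
        [OF continuous_on_product_then_coordinatewise[OF continuous_on_id]])
  then have "continuous_on UNIV (rel_shift g)"
    unfolding rel_shift_def by (intro continuous_on_coordinatewise_then_product)
  then have "rel_shift g \<in> borel_measurable borel"
    by (rule borel_measurable_continuous_onI)
  then show ?thesis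
    unfolding equivalences_borel_def
    by (intro measurable_restrict_space2 measurable_restrict_space1)
       (auto simp: space_restrict_space rel_shift_equivalences)
qed

definition rel_class :: "('g \<Rightarrow> 'g \<Rightarrow> bool) \<Rightarrow> 'g \<Rightarrow> 'g set" where
  "rel_class r g = {h. r g h}"

definition IRE :: "('g::group_add \<Rightarrow> 'g \<Rightarrow> bool) measure \<Rightarrow> bool" where
  "IRE \<rho> \<longleftrightarrow>
     prob_space \<rho> \<and> sets \<rho> = sets equivalences_borel \<and>
     (\<forall>g. distr \<rho> equivalences_borel (rel_shift g) = \<rho>)"

definition finite_IRE :: "('g::group_add \<Rightarrow> 'g \<Rightarrow> bool) measure \<Rightarrow> bool" where
  "finite_IRE \<rho> \<longleftrightarrow> IRE \<rho> \<and> (AE r in \<rho>. \<forall>g. finite (rel_class r g))"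

definition amenable_IRE :: "('g::group_add \<Rightarrow> 'g \<Rightarrow> bool) measure \<Rightarrow> bool" where
  "amenable_IRE \<rho> \<longleftrightarrow>
     IRE \<rho> \<and>
     (\<exists>L :: nat \<Rightarrow> ('g \<Rightarrow> 'g \<Rightarrow> bool) \<Rightarrow> 'g pmf.
        (\<forall>n. L n \<in> equivalences_borel \<rightarrow>\<^sub>M borel) \<and>
        (AE r in \<rho>. \<forall>g \<in> rel_class r 0.
           (\<lambda>n. dist (pmf_shift (- g) (L n r)) (L n (rel_shift (- g) r))) \<longlonglongrightarrow> 0))"

definition converges_weakly ::
    "(nat \<Rightarrow> ('g \<Rightarrow> 'g \<Rightarrow> bool) measure) \<Rightarrow> ('g \<Rightarrow> 'g \<Rightarrow> bool) measure \<Rightarrow> bool" where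
  "converges_weakly \<rho>s \<rho> \<longleftrightarrow>
     (\<forall>f :: ('g \<Rightarrow> 'g \<Rightarrow> bool) \<Rightarrow> real. continuous_on equivalences f \<longrightarrow>
        (\<lambda>n. integral\<^sup>L (\<rho>s n) f) \<longlonglongrightarrow> integral\<^sup>L \<rho> f)"

end

theory Submission
  imports Defs
begin

text \<open>
  Exactness of \<open>\<Gamma>\<close>, applied along a single orbit \<open>c \<mapsto> c.x\<^sub>0\<close>, gives kernels \<open>q\<^sub>k : \<Gamma> \<rightarrow> Prob(\<Gamma>)\<close>
  that are uniformly tight in \<open>c\<close> and asymptotically equivariant in \<open>k\<close>. On a relation \<open>r\<close> with
  finite classes the average of \<open>q\<^sub>k(c)\<close> over \<open>c \<in> [e]\<^sub>r\<close> is an almost equivariant probability measure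
  on \<open>\<Gamma>\<close>, with an error that does not depend on \<open>r\<close>. For each \<open>k\<close> and \<open>h\<close>, the weights of these
  averages at \<open>h\<close>, integrated against \<open>\<rho>\<^sub>n\<close> over clopen sets, converge along a suitable filter to a
  measure dominated by \<open>\<rho>\<close>; its density is the weight at \<open>h\<close> of \<open>\<lambda>\<^sub>k\<^sup>r\<close>. Linear inequalities between
  finitely many weights survive the passage to densities: tightness makes the limiting weights sum
  to 1, and almost equivariance on the clopen set \<open>{r. g \<in> [e]\<^sub>r}\<close> is inherited with the same error.
\<close>

section \<open>Kernels from exactness\<close>

text \<open>\<open>measurable_coordinatewise_then_product\<close> asks for a second countable
  codomain; with this instance it applies to \<open>'g \<Rightarrow> 'g \<Rightarrow> bool\<close>,
  so measurability can be checked entry by entry.\<close>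

instance bool :: second_countable_topology
proof
  have "open = generate_topology (UNIV :: bool set set)"
    by (auto simp: fun_eq_iff intro: Topological_Spaces.open_discrete generate_topology.Basis)
  then show "\<exists>B :: bool set set. countable B \<and> open = generate_topology B"
    by (intro exI[of _ UNIV]) (simp add: countable_finite)
qed

section \<open>Finite-sum estimates for the \<ell>1 distance\<close>

lemma pmf_summable_on: "pmf p summable_on A"
  by (rule summable_on_subset_banach[of _ UNIV])
     (auto intro!: summable_on_iff_abs_summable_on_real[THEN iffD2]
        abs_summable_equivalent[THEN iffD2] pmf_abs_summable)

lemma pmf_diff_summable_on: "(\<lambda>h. \<bar>pmf p h - pmf q h\<bar>) summable_on A"
proof -
  have "(\<lambda>h. pmf p h - pmf q h) summable_on A"
    using summable_on_add[OF pmf_summable_on[of p A] summable_on_uminus[THEN iffD2, OF pmf_summable_on[of q A]]]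
    by simp
  from summable_on_iff_abs_summable_on_real[THEN iffD1, OF this] show ?thesis
    by simp
qed

lemma has_sum_pmf_1: "(pmf p has_sum 1) UNIV"
proof -
  have "infsetsum (pmf p) UNIV = 1"
    by (rule infsetsum_pmf_eq_1) simp
  then have "infsum (pmf p) UNIV = 1"
    using infsetsum_infsum[OF pmf_abs_summable[of p UNIV]] by simp
  then show ?thesis
    using has_sum_infsum[OF pmf_summable_on[of p UNIV]] by simp
qed

lemma sum_pmf_le_1: "finite F \<Longrightarrow> sum (pmf p) F \<le> 1"
  by (metis measure_measure_pmf_finite measure_pmf.prob_le_1)

lemma sum_pmf_diff_le_dist: "finite F \<Longrightarrow> (\<Sum>h\<in>F. \<bar>pmf p h - pmf q h\<bar>) \<le> dist p q"
  unfolding dist_pmf_def by (intro finite_sum_le_infsum pmf_diff_summable_on) auto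

lemma dist_pmf_leI:
  assumes "\<And>F. finite F \<Longrightarrow> (\<Sum>h\<in>F. \<bar>pmf p h - pmf q h\<bar>) \<le> b"
  shows "dist p q \<le> b"
  unfolding dist_pmf_def
  by (intro infsum_le_finite_sums pmf_diff_summable_on assms)

text \<open>Bounds the set under the real supremum in the definition of topological amenability, so
  that the supremum dominates each of its elements.\<close>

lemma dist_pmf_le_2: "dist p (q :: 'a pmf) \<le> 2"
proof (rule dist_pmf_leI)
  fix F :: "'a set" assume F: "finite F"
  have "(\<Sum>h\<in>F. \<bar>pmf p h - pmf q h\<bar>) \<le> (\<Sum>h\<in>F. pmf p h + pmf q h)"
    by (intro sum_mono) (auto simp: abs_le_iff intro: add_increasing2)
  also have "\<dots> \<le> 2"
    using sum_pmf_le_1[OF F, of p] sum_pmf_le_1[OF F, of q] by (simp add: sum.distrib)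
  finally show "(\<Sum>h\<in>F. \<bar>pmf p h - pmf q h\<bar>) \<le> 2" .
qed

lemma ex_finite_sum_pmf_gt:
  assumes "e > 0"
  obtains F where "finite F" "sum (pmf p) F > 1 - e"
proof -
  have "(sum (pmf p) \<longlongrightarrow> 1) (finite_subsets_at_top UNIV)"
    using has_sum_pmf_1[of p] by (simp add: has_sum_def)
  then have "\<forall>\<^sub>F F in finite_subsets_at_top UNIV. sum (pmf p) F > 1 - e"
    using assms by (intro order_tendstoD(1)) auto
  then show ?thesis
    using that by (auto simp: eventually_finite_subsets_at_top)
qed

text \<open>Outside \<open>F\<close> the distance is at most the two missing masses, and the mass
  missed by \<open>q\<close> exceeds that missed by \<open>p\<close> by at most the discrepancy on
  \<open>F\<close>. Eliminating \<open>q\<close> in this way costs the factors 2.\<close>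

lemma dist_pmf_le_finite:
  assumes F: "finite F"
  shows "dist p q \<le> 2 * (\<Sum>h\<in>F. \<bar>pmf p h - pmf q h\<bar>) + 2 * (1 - sum (pmf p) F)"
proof (rule dist_pmf_leI)
  fix G :: "'a set" assume G: "finite G"
  let ?d = "\<lambda>h. \<bar>pmf p h - pmf q h\<bar>"
  have "sum ?d G \<le> sum ?d (F \<union> (G - F))"
    using F G by (intro sum_mono2) auto
  also have "\<dots> = sum ?d F + sum ?d (G - F)"
    using F G by (intro sum.union_disjoint) auto
  also have "sum ?d (G - F) \<le> (\<Sum>h\<in>G - F. pmf p h + pmf q h)"
    by (intro sum_mono) (auto simp: abs_le_iff intro: add_increasing2)
  also have "\<dots> = sum (pmf p) (F \<union> (G - F)) - sum (pmf p) F
      + (sum (pmf q) (F \<union> (G - F)) - sum (pmf q) F)"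
    using F G by (subst (1 2) sum.union_disjoint) (auto simp: sum.distrib)
  also have "\<dots> \<le> (1 - sum (pmf p) F) + (1 - sum (pmf q) F)"
    using F G by (intro add_mono diff_right_mono sum_pmf_le_1) auto
  finally have "sum ?d G \<le> sum ?d F + ((1 - sum (pmf p) F) + (1 - sum (pmf q) F))"
    by simp
  moreover have "sum (pmf q) F \<ge> sum (pmf p) F - sum ?d F"
    unfolding sum_subtractf[symmetric] by (intro sum_mono) auto
  ultimately show "sum ?d G \<le> 2 * sum ?d F + 2 * (1 - sum (pmf p) F)" by simp
qed

text \<open>Scheffe's lemma: the metric topology is that of pointwise convergence.\<close>

lemma open_pmf_eq_vimage:
  fixes U :: "'a pmf set"
  assumes "open U"
  obtains V where "open V" "U = pmf -` V"
proof -
  have "\<exists>V. open V \<and> pmf p \<in> V \<and> pmf -` V \<subseteq> U" if "p \<in> U" for p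
  proof -
    from assms that obtain e where e: "e > 0" "\<And>q. dist q p < e \<Longrightarrow> q \<in> U"
      unfolding open_dist by blast
    \<comment> \<open>\<open>dist_pmf_le_finite\<close> doubles both the missing mass and the
      discrepancy on \<open>F\<close>; with \<open>e / 4\<close> for each the total stays below
      \<open>e\<close>.\<close>
    obtain F where F: "finite F" "sum (pmf p) F > 1 - e / 4"
      using e(1) ex_finite_sum_pmf_gt[of "e / 4" p] by auto
    define V where "V = {f :: 'a \<Rightarrow> real. (\<Sum>h\<in>F. \<bar>pmf p h - f h\<bar>) < e / 4}"
    have "open V"
      unfolding V_def
      by (intro open_Collect_less continuous_intros continuous_on_product_then_coordinatewise)
    moreover have "pmf p \<in> V" using e(1) by (simp add: V_def)
    moreover have "pmf -` V \<subseteq> U"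
    proof
      fix q assume "q \<in> pmf -` V"
      then have "dist p q < e"
        using dist_pmf_le_finite[OF F(1), of p q] F(2) by (simp add: V_def)
      then show "q \<in> U" by (intro e(2)) (simp add: dist_commute)
    qed
    ultimately show ?thesis by blast
  qed
  then obtain W where W: "\<And>p. p \<in> U \<Longrightarrow> open (W p) \<and> pmf p \<in> W p \<and> pmf -` W p \<subseteq> U"
    by metis
  show ?thesis
    by (rule that[of "\<Union>p\<in>U. W p"]) (use W in auto)
qed

text \<open>Open sets of measures come from the product topology, by
  \<open>open_pmf_eq_vimage\<close>, and into a product over a countable index type measurability is
  coordinatewise.\<close>

lemma borel_measurable_pmfI:
  fixes L :: "'b \<Rightarrow> 'a::countable pmf"
  assumes "\<And>h. (\<lambda>r. pmf (L r) h) \<in> borel_measurable M"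
  shows "L \<in> borel_measurable M"
proof (rule borel_measurableI)
  fix U :: "'a pmf set" assume "open U"
  then obtain V where V: "open V" "U = pmf -` V" by (rule open_pmf_eq_vimage)
  have "(\<lambda>r. pmf (L r)) \<in> borel_measurable M"
    by (intro measurable_coordinatewise_then_product assms)
  then have "(\<lambda>r. pmf (L r)) -` V \<inter> space M \<in> sets M"
    using V(1) by (intro measurable_sets[of _ _ borel]) auto
  then show "L -` U \<inter> space M \<in> sets M"
    using V(2) by (simp add: vimage_def)
qed

text \<open>One half of Prokhorov's theorem: the measures giving a finite set \<open>F\<close> mass
  above \<open>1 - e\<close> form an open set, these sets cover \<open>K\<close>, and enlarging
  \<open>F\<close> enlarges them, so the union over a finite subcover serves all of
  \<open>K\<close>.\<close>

lemma compact_pmf_tight: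
  assumes K: "compact K" and e: "e > 0"
  obtains F where "finite F" "\<And>p. p \<in> K \<Longrightarrow> sum (pmf p) F > 1 - e"
proof -
  define W where "W F = {p :: 'a pmf. sum (pmf p) F > 1 - e}" for F
  have op: "open (W F)" if F: "finite F" for F
    unfolding open_dist
  proof
    fix p assume p: "p \<in> W F"
    show "\<exists>d>0. \<forall>q. dist q p < d \<longrightarrow> q \<in> W F"
    proof (intro exI conjI allI impI)
      show "sum (pmf p) F - (1 - e) > 0" using p by (simp add: W_def)
      fix q assume "dist q p < sum (pmf p) F - (1 - e)"
      moreover have "sum (pmf p) F - sum (pmf q) F \<le> (\<Sum>h\<in>F. \<bar>pmf q h - pmf p h\<bar>)"
        unfolding sum_subtractf[symmetric] by (intro sum_mono) auto
      ultimately show "q \<in> W F"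
        using sum_pmf_diff_le_dist[OF F, of q p] by (simp add: W_def)
    qed
  qed
  have "K \<subseteq> (\<Union>F\<in>{F. finite F}. W F)"
  proof
    fix p :: "'a pmf"
    obtain F where "finite F" "sum (pmf p) F > 1 - e"
      using e by (rule ex_finite_sum_pmf_gt)
    then show "p \<in> (\<Union>F\<in>{F. finite F}. W F)" by (auto simp: W_def)
  qed
  then obtain D where D: "D \<subseteq> {F. finite F}" "finite D" "K \<subseteq> (\<Union>F\<in>D. W F)"
    using compactE_image[OF K, of "{F. finite F}" W] op by (metis mem_Collect_eq)
  show ?thesis
  proof (rule that[of "\<Union>D"])
    show fin: "finite (\<Union>D)" using D by auto
    fix p assume "p \<in> K"
    then obtain F where F: "F \<in> D" "sum (pmf p) F > 1 - e"
      using D by (auto simp: W_def)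
    moreover have "sum (pmf p) F \<le> sum (pmf p) (\<Union>D)"
      using fin F by (intro sum_mono2) auto
    ultimately show "sum (pmf p) (\<Union>D) > 1 - e" by simp
  qed
qed

text \<open>The kernels are \<open>\<eta> k\<close> along the orbit of one point, and
  \<open>\<delta> g k\<close> is the supremum in the definition of amenability. Compactness survives
  as the first clause: the image of the space under \<open>\<eta> k\<close> is compact, hence tight,
  so \<open>S\<close> does not depend on \<open>c\<close>.\<close>

lemma exact_group_kernels:
  assumes "exact_group TYPE('g::group_add) TYPE('x)"
  obtains q :: "nat \<Rightarrow> 'g::group_add \<Rightarrow> 'g pmf" and \<delta> :: "'g::group_add \<Rightarrow> nat \<Rightarrow> real"
  where "\<And>k m. \<exists>S. finite S \<and> (\<forall>c. sum (pmf (q k c)) S > 1 - 1 / real (Suc m))"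
    and "\<And>g k c. dist (pmf_shift g (q k c)) (q k (g + c)) \<le> \<delta> g k"
    and "\<And>g. \<delta> g \<longlonglongrightarrow> 0"
proof -
  obtain X :: "'x topology" and act :: "'g \<Rightarrow> 'x \<Rightarrow> 'x" and \<eta> :: "nat \<Rightarrow> 'x \<Rightarrow> 'g pmf" and x0
    where X: "compact_space X" "x0 \<in> topspace X" and act: "homeo_action X act"
      and cont: "\<And>k. continuous_map X euclidean (\<eta> k)"
      and lim: "\<And>g. (\<lambda>k. SUP x\<in>topspace X. dist (pmf_shift g (\<eta> k x)) (\<eta> k (act g x))) \<longlonglongrightarrow> 0"
    using assms unfolding exact_group_def topologically_amenable_action_def by blast
  have act_in: "act c x0 \<in> topspace X" for c
    using act X(2) unfolding homeo_action_def
    by (metis homeomorphic_imp_surjective_map imageI)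
  show ?thesis
  proof (rule that[of "\<lambda>k c. \<eta> k (act c x0)"])
    fix k m :: nat
    have "compact (\<eta> k ` topspace X)"
      using image_compactin[OF X(1)[unfolded compact_space_def] cont[of k]]
      by (simp add: compactin_euclidean_iff)
    then obtain S where "finite S" "\<And>p. p \<in> \<eta> k ` topspace X \<Longrightarrow> sum (pmf p) S > 1 - 1 / real (Suc m)"
      using compact_pmf_tight[of "\<eta> k ` topspace X" "1 / real (Suc m)"] by auto
    then show "\<exists>S. finite S \<and> (\<forall>c. sum (pmf (\<eta> k (act c x0))) S > 1 - 1 / real (Suc m))"
      using act_in by blast
  next
    fix g k c
    have "act (g + c) x0 = act g (act c x0)"
      using act X(2) unfolding homeo_action_def by blast
    moreover have "dist (pmf_shift g (\<eta> k (act c x0))) (\<eta> k (act g (act c x0)))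
        \<le> (SUP x\<in>topspace X. dist (pmf_shift g (\<eta> k x)) (\<eta> k (act g x)))"
      by (rule cSUP_upper[OF act_in]) (auto intro!: bdd_aboveI[of _ 2] dist_pmf_le_2)
    ultimately show "dist (pmf_shift g (\<eta> k (act c x0))) (\<eta> k (act (g + c) x0))
        \<le> (SUP x\<in>topspace X. dist (pmf_shift g (\<eta> k x)) (\<eta> k (act g x)))"
      by simp
  qed (rule lim)
qed

section \<open>Clopen sets of equivalence relations\<close>

text \<open>Stated through continuity of the indicator, which is then itself a test function for
  weak convergence.\<close>

definition clopens :: "('g \<Rightarrow> 'g \<Rightarrow> bool) set set" where
  "clopens = {A. A \<subseteq> equivalences \<and> continuous_on equivalences (indicat_real A)}"

lemma algebra_clopens: "algebra equivalences clopens"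
  unfolding algebra_iff_Int
proof (intro conjI ballI)
  show "equivalences - A \<in> clopens" if "A \<in> clopens" for A :: "('a \<Rightarrow> 'a \<Rightarrow> bool) set"
  proof -
    have "continuous_on equivalences (\<lambda>r. 1 - indicat_real A r)"
      using that by (intro continuous_intros) (auto simp: clopens_def)
    then have "continuous_on equivalences (indicat_real (equivalences - A))"
      by (rule continuous_on_eq) (auto simp: indicator_def)
    then show ?thesis by (auto simp: clopens_def)
  qed
  show "A \<inter> B \<in> clopens" if "A \<in> clopens" "B \<in> clopens" for A B :: "('a \<Rightarrow> 'a \<Rightarrow> bool) set"
    using that by (auto simp: clopens_def indicator_inter_arith intro!: continuous_on_mult)
qed (auto simp: clopens_def continuous_on_const)

lemma continuous_on_rel_apply: "continuous_on UNIV (\<lambda>r :: 'a \<Rightarrow> 'a \<Rightarrow> bool. r a b)"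
  by (rule continuous_on_product_then_coordinatewise
      [OF continuous_on_product_then_coordinatewise[OF continuous_on_id]])

lemma rel_clopen: "{r \<in> equivalences. r a b} \<in> clopens"
proof -
  have "continuous_on UNIV (of_bool :: bool \<Rightarrow> real)"
    by (simp add: continuous_on_open_vimage Topological_Spaces.open_discrete)
  then have "continuous_on UNIV (\<lambda>r :: 'a \<Rightarrow> 'a \<Rightarrow> bool. of_bool (r a b) :: real)"
    using continuous_on_compose2[OF _ continuous_on_rel_apply[of a b]] by blast
  then have "continuous_on equivalences (\<lambda>r :: 'a \<Rightarrow> 'a \<Rightarrow> bool. of_bool (r a b) :: real)"
    by (rule continuous_on_subset) auto
  then have "continuous_on equivalences (indicat_real {r \<in> equivalences. r a b})"
    by (rule continuous_on_eq) (auto simp: indicator_def)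
  then show ?thesis by (auto simp: clopens_def)
qed

lemma clopens_sub: "A \<in> clopens \<Longrightarrow> A \<subseteq> equivalences"
  by (auto simp: clopens_def)

lemma clopens_Pow: "clopens \<subseteq> Pow equivalences"
  by (auto simp: clopens_def)

lemma Int_stable_clopens: "Int_stable clopens"
  using algebra_clopens by (auto simp: Int_stable_def algebra_iff_Int)

lemma space_equivalences_borel [simp]: "space equivalences_borel = equivalences"
  by (simp add: equivalences_borel_def space_restrict_space)

lemma clopens_sets: "A \<in> clopens \<Longrightarrow> A \<in> sets equivalences_borel"
proof -
  assume A: "A \<in> clopens"
  then have "indicat_real A \<in> borel_measurable equivalences_borel"
    unfolding equivalences_borel_def
    by (intro borel_measurable_continuous_on_restrict) (auto simp: clopens_def)
  then have "A \<inter> space equivalences_borel \<in> sets equivalences_borel"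
    by (simp add: borel_measurable_indicator_iff)
  then show ?thesis
    using A by (simp add: clopens_def Int_absorb2)
qed

text \<open>The sets \<open>{r \<in> equivalences. r a b}\<close> are clopen and, \<open>'g\<close>
  being countable, already make the identity map Borel. Thus \<open>clopens\<close> is a generating
  algebra, fit for Dynkin inductions and for Caratheodory extension.\<close>

lemma sets_equivalences_borel:
  "sets (equivalences_borel :: ('g::countable \<Rightarrow> 'g \<Rightarrow> bool) measure) = sigma_sets equivalences clopens"
proof
  let ?S = "sigma equivalences clopens :: ('g \<Rightarrow> 'g \<Rightarrow> bool) measure"
  have [simp]: "space ?S = equivalences" "sets ?S = sigma_sets equivalences clopens"
    using space_measure_of[OF clopens_Pow] sets_measure_of[OF clopens_Pow] by blast+
  have "(\<lambda>r. r a b) \<in> borel_measurable ?S" for a b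
  proof -
    have "{r \<in> space ?S. r a b} \<in> sets ?S"
      using rel_clopen[of a b] by (auto intro: sigma_sets.Basic)
    then have "Measurable.pred ?S (\<lambda>r. r a b)" 
      by (subst pred_def)
    then show ?thesis
      by (rule measurable_compose[where g = "\<lambda>x. x"]) simp
  qed
  then have "(\<lambda>r. r) \<in> borel_measurable ?S"
    by (intro measurable_coordinatewise_then_product)
  then have "B \<inter> equivalences \<in> sigma_sets equivalences clopens" if "B \<in> sets borel"
    for B :: "('g \<Rightarrow> 'g \<Rightarrow> bool) set"
    using measurable_sets[OF _ that, of "\<lambda>r. r" ?S] by simp
  then show "sets equivalences_borel \<subseteq> sigma_sets equivalences (clopens :: ('g \<Rightarrow> 'g \<Rightarrow> bool) set set)"
    by (auto simp: equivalences_borel_def sets_restrict_space Int_commute)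
  show "sigma_sets equivalences clopens \<subseteq> sets (equivalences_borel :: ('g \<Rightarrow> 'g \<Rightarrow> bool) measure)"
    using sets.sigma_sets_subset[of clopens equivalences_borel] clopens_sets by auto
qed

lemma rel_shift_minus_cancel [simp]: "rel_shift (- g) (rel_shift g r) = r"
  by (simp add: rel_shift_def add.assoc[symmetric])

lemma clopens_vimage_rel_shift:
  assumes A: "A \<in> clopens"
  shows "rel_shift g -` A \<inter> equivalences \<in> clopens"
proof -
  have "continuous_on UNIV (rel_shift g)"
    unfolding rel_shift_def by (intro continuous_on_coordinatewise_then_product continuous_on_rel_apply)
  then have "continuous_on equivalences (rel_shift g)"
    by (rule continuous_on_subset) auto
  then have "continuous_on equivalences (\<lambda>r. indicat_real A (rel_shift g r))"
    using A by (auto simp: clopens_def intro!: continuous_on_compose2[of equivalences "indicat_real A"]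
        rel_shift_equivalences)
  then have "continuous_on equivalences (indicat_real (rel_shift g -` A \<inter> equivalences))"
    by (rule continuous_on_eq) (auto simp: indicator_def)
  then show ?thesis by (auto simp: clopens_def)
qed

text \<open>
  By Tychonoff, along one filter all coordinates of a bounded sequence converge, also for an
  uncountable index set, for which no convergent subsequence need exist. Taking bounded Borel
  functions as indices, this makes \<open>\<integral> f d\<rho>\<^sub>n\<close> converge for all of them at once.
\<close>

lemma ex_filter_converging:
  fixes \<Phi> :: "nat \<Rightarrow> 'i \<Rightarrow> real"
  assumes "\<And>n i. \<bar>\<Phi> n i\<bar> \<le> K"
  obtains F where "F \<noteq> bot" "F \<le> sequentially" "\<And>i. \<exists>l. ((\<lambda>n. \<Phi> n i) \<longlongrightarrow> l) F"
proof -
  define S :: "('i \<Rightarrow> real) set" where "S = (\<Pi>\<^sub>E i\<in>UNIV. {- K..K})"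
  have "compactin (product_topology (\<lambda>_. euclidean) UNIV) S"
    unfolding S_def compactin_PiE by (simp add: compactin_euclidean_iff)
  then have "compact S"
    by (simp add: euclidean_product_topology compactin_euclidean_iff)
  moreover have "filtermap \<Phi> sequentially \<noteq> bot" by (simp add: filtermap_bot_iff)
  moreover have "\<forall>\<^sub>F x in filtermap \<Phi> sequentially. x \<in> S"
    using assms by (auto simp: eventually_filtermap S_def abs_le_iff minus_le_iff intro!: always_eventually)
  ultimately obtain x where x: "inf (nhds x) (filtermap \<Phi> sequentially) \<noteq> bot"
    unfolding compact_filter by blast
  define F where "F = inf sequentially (filtercomap \<Phi> (nhds x))"
  have "F \<noteq> bot"
  proof
    assume "F = bot"
    then obtain P Q where PQ: "eventually P sequentially" "eventually Q (nhds x)" "\<And>n. P n \<Longrightarrow> \<not> Q (\<Phi> n)"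
      unfolding F_def trivial_limit_def eventually_inf eventually_filtercomap by blast
    then have "\<forall>\<^sub>F y in filtermap \<Phi> sequentially. \<not> Q y"
      by (auto simp: eventually_filtermap elim: eventually_mono)
    with PQ(2) have "eventually (\<lambda>_. False) (inf (nhds x) (filtermap \<Phi> sequentially))"
      unfolding eventually_inf by blast
    with x show False by (simp add: trivial_limit_def)
  qed
  moreover have "F \<le> sequentially" by (simp add: F_def)
  moreover have "((\<lambda>n. \<Phi> n i) \<longlongrightarrow> x i) F" for i
  proof -
    have "filterlim \<Phi> (nhds x) (filtercomap \<Phi> (nhds x))" by (rule filterlim_filtercomap)
    then have "filterlim \<Phi> (nhds x) F"
      unfolding F_def by (rule filterlim_mono) auto
    moreover have "continuous_on UNIV (\<lambda>y :: 'i \<Rightarrow> real. y i)"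
      by (rule continuous_on_product_then_coordinatewise[OF continuous_on_id])
    then have "((\<lambda>y. y i) \<longlongrightarrow> x i) (at x)"
      by (simp add: continuous_on_def)
    then have "filterlim (\<lambda>y. y i) (nhds (x i)) (nhds x)"
      by (rule tendsto_at_iff_tendsto_nhds[of "\<lambda>y. y i" x, THEN iffD1])
    ultimately show ?thesis
      by (rule filterlim_compose[rotated])
  qed
  ultimately show ?thesis using that by blast
qed

text \<open>The bound is on the whole type rather than on \<open>equivalences\<close>, so that
  rescaling into \<open>[0, 1]\<close> carries no side condition on \<open>r\<close>.\<close>

definition bounded_borel :: "(('g \<Rightarrow> 'g \<Rightarrow> bool) \<Rightarrow> real) \<Rightarrow> bool" where
  "bounded_borel f \<longleftrightarrow> f \<in> borel_measurable equivalences_borel \<and> (\<exists>K. \<forall>r. \<bar>f r\<bar> \<le> K)"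

section \<open>Closure properties of bounded Borel functions\<close>

lemma bounded_borelI: "f \<in> borel_measurable equivalences_borel \<Longrightarrow> (\<And>r. \<bar>f r\<bar> \<le> K) \<Longrightarrow> bounded_borel f"
  by (auto simp: bounded_borel_def)

lemma bounded_borel_const [simp]: "bounded_borel (\<lambda>_. c)"
  by (auto simp: bounded_borel_def)

lemma bounded_borel_add:
  assumes "bounded_borel f" "bounded_borel g"
  shows "bounded_borel (\<lambda>r. f r + g r)"
proof -
  from assms obtain K K' where K: "\<And>r. \<bar>f r\<bar> \<le> K" "\<And>r. \<bar>g r\<bar> \<le> K'"
    by (auto simp: bounded_borel_def)
  have "\<bar>f r + g r\<bar> \<le> K + K'" for r using K[of r] by linarith
  then show ?thesis using assms by (auto simp: bounded_borel_def)
qed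

lemma bounded_borel_mult:
  assumes "bounded_borel f" "bounded_borel g"
  shows "bounded_borel (\<lambda>r. f r * g r)"
proof -
  from assms obtain K K' where K: "\<And>r. \<bar>f r\<bar> \<le> K" "\<And>r. \<bar>g r\<bar> \<le> K'"
    by (auto simp: bounded_borel_def)
  have "\<bar>f r * g r\<bar> \<le> K * K'" for r
    unfolding abs_mult by (intro mult_mono K) (use K(1)[of r] in auto)
  then show ?thesis using assms by (auto simp: bounded_borel_def)
qed

lemma bounded_borel_diff:
  assumes "bounded_borel f" "bounded_borel g"
  shows "bounded_borel (\<lambda>r. f r - g r)"
  using bounded_borel_add[OF assms(1) bounded_borel_mult[OF bounded_borel_const[of "- 1"] assms(2)]] by simp

lemma bounded_borel_abs: "bounded_borel f \<Longrightarrow> bounded_borel (\<lambda>r. \<bar>f r\<bar>)"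
  by (auto simp: bounded_borel_def)

lemma bounded_borel_indicator: "A \<in> sets equivalences_borel \<Longrightarrow> bounded_borel (indicat_real A)"
  by (rule bounded_borelI[of _ 1]) (auto simp: indicator_def)

lemma bounded_borel_shift: "bounded_borel f \<Longrightarrow> bounded_borel (\<lambda>r. f (rel_shift g r))"
  unfolding bounded_borel_def using measurable_compose[OF rel_shift_measurable] by blast

section \<open>Limit densities\<close>

lemma measure_le_of_clopens_complement:
  fixes M M' \<rho> :: "('g::countable \<Rightarrow> 'g \<Rightarrow> bool) measure"
  assumes sets: "sets M = sets equivalences_borel" "sets M' = sets equivalences_borel"
      "sets \<rho> = sets equivalences_borel"
    and fin: "finite_measure M" "finite_measure M'" "finite_measure \<rho>"
    and eq: "\<And>A. A \<in> clopens \<Longrightarrow> measure M A + measure M' A = measure \<rho> A"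
    and A: "A \<in> sets equivalences_borel"
  shows "measure M A \<le> measure \<rho> A"
proof -
  interpret M: finite_measure M by fact
  interpret M': finite_measure M' by fact
  interpret \<rho>: finite_measure \<rho> by fact
  have space: "space M = equivalences" "space M' = equivalences" "space \<rho> = equivalences"
    using sets[THEN sets_eq_imp_space_eq] by auto
  from A have "A \<in> sigma_sets equivalences clopens"
    by (simp add: sets_equivalences_borel)
  with Int_stable_clopens clopens_Pow have "measure M A + measure M' A = measure \<rho> A"
  proof (induction rule: sigma_sets_induct_disjoint)
    case (compl A)
    then have "measure M (space M - A) = measure M (space M) - measure M A"
      "measure M' (space M' - A) = measure M' (space M') - measure M' A"
      "measure \<rho> (space \<rho> - A) = measure \<rho> (space \<rho>) - measure \<rho> A"
      by (auto intro!: M.finite_measure_compl M'.finite_measure_compl \<rho>.finite_measure_compl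
          simp: sets sets_equivalences_borel)
    moreover have "(equivalences :: ('g \<Rightarrow> 'g \<Rightarrow> bool) set) \<in> clopens"
      using algebra_clopens algebra.top by blast
    ultimately show ?case
      using compl(2) eq[of equivalences] by (simp add: space)
  next
    case (union A)
    have "range A \<subseteq> sets M" "range A \<subseteq> sets M'" "range A \<subseteq> sets \<rho>"
      using union(2) by (auto simp: sets sets_equivalences_borel)
    then have "(\<lambda>i. measure M (A i)) sums measure M (\<Union>i. A i)"
      "(\<lambda>i. measure M' (A i)) sums measure M' (\<Union>i. A i)"
      "(\<lambda>i. measure \<rho> (A i)) sums measure \<rho> (\<Union>i. A i)"
      using union(1) by (auto intro: M.finite_measure_UNION M'.finite_measure_UNION \<rho>.finite_measure_UNION)
    then have "(\<lambda>i. measure \<rho> (A i)) sums (measure M (\<Union>i. A i) + measure M' (\<Union>i. A i))"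
      using sums_add union(3) by fastforce
    with \<open>(\<lambda>i. measure \<rho> (A i)) sums measure \<rho> (\<Union>i. A i)\<close> show ?case
      by (metis sums_unique2)
  qed (auto simp: eq)
  then show ?thesis by (smt (verit) measure_nonneg)
qed

text \<open>Integrals over all measurable sets determine an integrable function almost everywhere.
  Their equality is preserved by complements and countable disjoint unions, so the Int-stable
  generator \<open>clopens\<close> suffices.\<close>

lemma AE_eq_of_clopens:
  fixes \<rho> :: "('g::countable \<Rightarrow> 'g \<Rightarrow> bool) measure" and f h :: "_ \<Rightarrow> real"
  assumes sets: "sets \<rho> = sets equivalences_borel"
    and int: "integrable \<rho> f" "integrable \<rho> h"
    and eq: "\<And>A. A \<in> clopens \<Longrightarrow> (\<integral>r. f r * indicator A r \<partial>\<rho>) = (\<integral>r. h r * indicator A r \<partial>\<rho>)"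
  shows "AE r in \<rho>. f r = h r"
proof (rule density_unique_real[OF int])
  have space: "space \<rho> = equivalences"
    using sets[THEN sets_eq_imp_space_eq] by auto
  have set_int: "set_integrable \<rho> A f" "set_integrable \<rho> A h" if "A \<in> sets \<rho>" for A
    using that int integrable_mult_indicator unfolding set_integrable_def by blast+
  have eq': "(LINT r:A|\<rho>. f r) = (LINT r:A|\<rho>. h r)" if "A \<in> clopens" for A
    using eq[OF that] by (simp add: set_lebesgue_integral_def mult.commute)
  fix A assume "A \<in> sets \<rho>"
  then have "A \<in> sigma_sets equivalences clopens"
    by (simp add: sets sets_equivalences_borel)
  with Int_stable_clopens clopens_Pow show "(LINT r:A|\<rho>. f r) = (LINT r:A|\<rho>. h r)"
  proof (induction rule: sigma_sets_induct_disjoint)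
    case (compl A)
    then have A: "A \<in> sets \<rho>" by (simp add: sets sets_equivalences_borel)
    have E: "(equivalences :: ('g \<Rightarrow> 'g \<Rightarrow> bool) set) \<in> clopens" "equivalences \<in> sets \<rho>"
      using algebra_clopens algebra.top sets.top[of \<rho>] by (blast, simp add: space)
    have "(LINT r:equivalences - A|\<rho>. u r) = (LINT r:equivalences|\<rho>. u r) - (LINT r:A|\<rho>. u r)"
      if "\<And>A. A \<in> sets \<rho> \<Longrightarrow> set_integrable \<rho> A u" for u :: "_ \<Rightarrow> real"
    proof -
      have "(LINT r:(equivalences - A) \<union> A|\<rho>. u r) = (LINT r:equivalences - A|\<rho>. u r) + (LINT r:A|\<rho>. u r)"
        using A E that by (intro set_integral_Un) auto
      moreover have "(equivalences - A) \<union> A = equivalences"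
        using sets.sets_into_space[OF A] space by auto
      ultimately show ?thesis by simp
    qed
    then show ?case
      using set_int compl(2) eq'[OF E(1)] by simp
  next
    case (union A)
    have A: "A i \<in> sets \<rho>" for i
      using union(2) by (auto simp: sets sets_equivalences_borel)
    then have "(\<Union>i. A i) \<in> sets \<rho>" by auto
    with A union show ?case
      by (subst (1 2) lebesgue_integral_countable_add)
        (auto simp: set_int disjoint_family_on_def)
  next
    case (basic A)
    then show ?case by (rule eq')
  next
    case empty
    then show ?case by (simp add: set_lebesgue_integral_def)
  qed
qed

text \<open>Limits are along a filter \<open>F\<close> in place of a subsequence, since
  \<open>integral_convergent\<close> concerns uncountably many functions. The limits it provides
  need not be integrals against \<open>\<rho>\<close>; the link to \<open>\<rho>\<close> is
  \<open>measure_tendsto\<close>.\<close>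

locale IRE_limit =
  fixes \<rho>s :: "nat \<Rightarrow> ('g::{group_add, countable} \<Rightarrow> 'g \<Rightarrow> bool) measure"
    and \<rho> :: "('g \<Rightarrow> 'g \<Rightarrow> bool) measure"
    and F :: "nat filter"
  assumes IREs: "IRE (\<rho>s n)"
    and IRE: "IRE \<rho>"
    and F_nontrivial: "F \<noteq> bot"
    and measure_tendsto: "A \<in> clopens \<Longrightarrow> ((\<lambda>n. measure (\<rho>s n) A) \<longlongrightarrow> measure \<rho> A) F"
    and integral_convergent: "bounded_borel f \<Longrightarrow> \<exists>l. ((\<lambda>n. \<integral>r. f r \<partial>\<rho>s n) \<longlongrightarrow> l) F"
begin

sublocale \<rho>: prob_space \<rho>
  using IRE by (simp add: IRE_def)

sublocale \<rho>s: prob_space "\<rho>s n" for n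
  using IREs by (simp add: IRE_def)

lemma sets_\<rho> [simp, measurable_cong]: "sets \<rho> = sets equivalences_borel"
  and sets_\<rho>s [simp, measurable_cong]: "sets (\<rho>s n) = sets equivalences_borel"
  using IRE IREs by (simp_all add: IRE_def)

lemma space_\<rho> [simp]: "space \<rho> = equivalences"
  and space_\<rho>s [simp]: "space (\<rho>s n) = equivalences"
  using sets_eq_imp_space_eq[OF sets_\<rho>] sets_eq_imp_space_eq[OF sets_\<rho>s] by simp_all

lemma distr_\<rho>: "distr \<rho> equivalences_borel (rel_shift g) = \<rho>"
  and distr_\<rho>s: "distr (\<rho>s n) equivalences_borel (rel_shift g) = \<rho>s n"
  using IRE IREs by (simp_all add: IRE_def)

lemma bounded_borel_integrable:
  assumes "bounded_borel f"
  shows "integrable \<rho> f" "integrable (\<rho>s n) f"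
proof -
  from assms obtain K where K: "f \<in> borel_measurable equivalences_borel" "\<And>r. \<bar>f r\<bar> \<le> K"
    by (auto simp: bounded_borel_def)
  show "integrable \<rho> f"
    by (rule \<rho>.integrable_const_bound[of _ K]) (use K in auto)
  show "integrable (\<rho>s n) f"
    by (rule \<rho>s.integrable_const_bound[of _ K]) (use K in auto)
qed

text \<open>\<open>a\<close> is the density with respect to \<open>\<rho>\<close> of the limit along
  \<open>F\<close> of the measures with density \<open>b\<close> with respect to
  \<open>\<rho>s n\<close>. For discontinuous \<open>b\<close> it may differ from \<open>b\<close>,
  since weak convergence does not control such integrals.\<close>

definition limit_density :: "(('g \<Rightarrow> 'g \<Rightarrow> bool) \<Rightarrow> real) \<Rightarrow> (('g \<Rightarrow> 'g \<Rightarrow> bool) \<Rightarrow> real) \<Rightarrow> bool" where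
  "limit_density b a \<longleftrightarrow> bounded_borel b \<and> integrable \<rho> a \<and>
     (\<forall>A\<in>clopens. ((\<lambda>n. \<integral>r. b r * indicator A r \<partial>\<rho>s n) \<longlongrightarrow> (\<integral>r. a r * indicator A r \<partial>\<rho>)) F)"

lemma limit_density_bounded: "limit_density b a \<Longrightarrow> bounded_borel b"
  by (simp add: limit_density_def)

lemma bounded_borel_clopen_mult:
  "bounded_borel f \<Longrightarrow> A \<in> clopens \<Longrightarrow> bounded_borel (\<lambda>r. f r * indicator A r)"
  by (intro bounded_borel_mult bounded_borel_indicator clopens_sets)

lemma integrable_clopen_mult:
  fixes f :: "_ \<Rightarrow> real"
  shows "integrable \<rho> f \<Longrightarrow> A \<in> clopens \<Longrightarrow> integrable \<rho> (\<lambda>r. f r * indicator A r)"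
  using integrable_mult_indicator[of A \<rho> f] by (simp add: clopens_sets mult.commute)

lemma limit_density_unique:
  assumes "limit_density b a" "limit_density b a'"
  shows "AE r in \<rho>. a r = a' r"
  by (rule AE_eq_of_clopens)
     (use assms in \<open>auto simp: limit_density_def intro: tendsto_unique[OF F_nontrivial]\<close>)

section \<open>Algebra and invariance of limit densities\<close>

lemma limit_density_const: "limit_density (\<lambda>_. c) (\<lambda>_. c)"
  unfolding limit_density_def
proof (intro conjI ballI)
  fix A :: "('g \<Rightarrow> 'g \<Rightarrow> bool) set" assume A: "A \<in> clopens"
  then show "((\<lambda>n. \<integral>r. c * indicator A r \<partial>\<rho>s n) \<longlongrightarrow> (\<integral>r. c * indicator A r \<partial>\<rho>)) F"
    using tendsto_mult_left[OF measure_tendsto[OF A], of c] clopens_sub[OF A] by (simp add: Int_absorb2)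
qed auto

lemma limit_density_add:
  assumes "limit_density b a" "limit_density b' a'"
  shows "limit_density (\<lambda>r. b r + b' r) (\<lambda>r. a r + a' r)"
  unfolding limit_density_def
proof (intro conjI ballI)
  show "bounded_borel (\<lambda>r. b r + b' r)" "integrable \<rho> (\<lambda>r. a r + a' r)"
    using assms by (auto simp: limit_density_def intro: bounded_borel_add)
  fix A :: "('g \<Rightarrow> 'g \<Rightarrow> bool) set" assume A: "A \<in> clopens"
  have "((\<lambda>n. (\<integral>r. b r * indicator A r \<partial>\<rho>s n) + (\<integral>r. b' r * indicator A r \<partial>\<rho>s n))
      \<longlongrightarrow> (\<integral>r. a r * indicator A r \<partial>\<rho>) + (\<integral>r. a' r * indicator A r \<partial>\<rho>)) F"
    using assms A by (intro tendsto_add) (auto simp: limit_density_def)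
  then show "((\<lambda>n. \<integral>r. (b r + b' r) * indicator A r \<partial>\<rho>s n)
      \<longlongrightarrow> (\<integral>r. (a r + a' r) * indicator A r \<partial>\<rho>)) F"
    using assms A by (simp add: distrib_right limit_density_def
        bounded_borel_integrable bounded_borel_clopen_mult integrable_clopen_mult)
qed

lemma limit_density_cmult:
  assumes "limit_density b a"
  shows "limit_density (\<lambda>r. c * b r) (\<lambda>r. c * a r)"
  unfolding limit_density_def
proof (intro conjI ballI)
  show "bounded_borel (\<lambda>r. c * b r)" "integrable \<rho> (\<lambda>r. c * a r)"
    using assms by (auto simp: limit_density_def intro: bounded_borel_mult)
  fix A :: "('g \<Rightarrow> 'g \<Rightarrow> bool) set" assume A: "A \<in> clopens"
  have "((\<lambda>n. c * (\<integral>r. b r * indicator A r \<partial>\<rho>s n)) \<longlongrightarrow> c * (\<integral>r. a r * indicator A r \<partial>\<rho>)) F"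
    using assms A by (intro tendsto_mult_left) (auto simp: limit_density_def)
  then show "((\<lambda>n. \<integral>r. c * b r * indicator A r \<partial>\<rho>s n) \<longlongrightarrow> (\<integral>r. c * a r * indicator A r \<partial>\<rho>)) F"
    by (simp add: mult.assoc)
qed

lemma limit_density_diff:
  assumes "limit_density b a" "limit_density b' a'"
  shows "limit_density (\<lambda>r. b r - b' r) (\<lambda>r. a r - a' r)"
  using limit_density_add[OF assms(1) limit_density_cmult[OF assms(2), of "- 1"]] by simp

lemma limit_density_sum:
  "(\<And>i. i \<in> I \<Longrightarrow> limit_density (b i) (a i)) \<Longrightarrow>
    limit_density (\<lambda>r. \<Sum>i\<in>I. b i r) (\<lambda>r. \<Sum>i\<in>I. a i r)"
  by (induction I rule: infinite_finite_induct) (auto intro: limit_density_add limit_density_const)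

text \<open>The integrals see \<open>b\<close> only up to null sets of the \<open>\<rho>s n\<close>,
  and these sets need not be null for \<open>\<rho>\<close>. This is how finiteness of classes,
  which may be lost in the limit, can be exploited before it.\<close>

lemma limit_density_cong:
  assumes "limit_density b a" "bounded_borel b'" "\<And>n. AE r in \<rho>s n. b r = b' r"
  shows "limit_density b' a"
  unfolding limit_density_def
proof (intro conjI ballI)
  fix A :: "('g \<Rightarrow> 'g \<Rightarrow> bool) set" assume A: "A \<in> clopens"
  have "(\<integral>r. b' r * indicator A r \<partial>\<rho>s n) = (\<integral>r. b r * indicator A r \<partial>\<rho>s n)" for n
    using assms(3)[of n] bounded_borel_clopen_mult[OF assms(2) A]
      bounded_borel_clopen_mult[OF limit_density_bounded[OF assms(1)] A]
    by (intro integral_cong_AE) (auto simp: bounded_borel_def)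
  then show "((\<lambda>n. \<integral>r. b' r * indicator A r \<partial>\<rho>s n) \<longlongrightarrow> (\<integral>r. a r * indicator A r \<partial>\<rho>)) F"
    using assms(1) A by (simp add: limit_density_def)
qed (use assms in \<open>auto simp: limit_density_def\<close>)

text \<open>A further clopen indicator only replaces the test set by an intersection. With
  \<open>{r \<in> equivalences. r 0 g}\<close> this localises almost equivariance to the relations
  for which it is available.\<close>

lemma limit_density_indicator:
  assumes "limit_density b a" "A \<in> clopens"
  shows "limit_density (\<lambda>r. b r * indicator A r) (\<lambda>r. a r * indicator A r)"
  unfolding limit_density_def
proof (intro conjI ballI)
  fix B :: "('g \<Rightarrow> 'g \<Rightarrow> bool) set" assume B: "B \<in> clopens"
  have "A \<inter> B \<in> clopens"
    using assms(2) B algebra_clopens by (auto simp: algebra_iff_Int)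
  then show "((\<lambda>n. \<integral>r. b r * indicator A r * indicator B r \<partial>\<rho>s n)
      \<longlongrightarrow> (\<integral>r. a r * indicator A r * indicator B r \<partial>\<rho>)) F"
    using assms(1) by (simp add: limit_density_def mult.assoc indicator_inter_arith[symmetric])
qed (use assms in \<open>auto simp: limit_density_def bounded_borel_clopen_mult integrable_clopen_mult\<close>)

lemma integral_\<rho>_shift:
  fixes f :: "_ \<Rightarrow> real"
  assumes "f \<in> borel_measurable equivalences_borel"
  shows "(\<integral>r. f (rel_shift g r) \<partial>\<rho>) = (\<integral>r. f r \<partial>\<rho> :: real)"
    and "(\<integral>r. f (rel_shift g r) \<partial>\<rho>s n) = (\<integral>r. f r \<partial>\<rho>s n :: real)"
  using integral_distr[of "rel_shift g" \<rho> equivalences_borel f]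
    integral_distr[of "rel_shift g" "\<rho>s n" equivalences_borel f] assms
  by (simp_all add: distr_\<rho> distr_\<rho>s rel_shift_measurable measurable_cong_sets[OF sets_\<rho> refl]
      measurable_cong_sets[OF sets_\<rho>s refl])

text \<open>A change of variables under the invariant measures \<open>\<rho>s n\<close> and
  \<open>\<rho>\<close> moves the shift onto the test set, which stays clopen.\<close>

lemma limit_density_shift:
  assumes "limit_density b a"
  shows "limit_density (\<lambda>r. b (rel_shift g r)) (\<lambda>r. a (rel_shift g r))"
  unfolding limit_density_def
proof (intro conjI ballI)
  show "bounded_borel (\<lambda>r. b (rel_shift g r))"
    using assms by (auto simp: limit_density_def intro: bounded_borel_shift)
  have a: "integrable \<rho> a" "a \<in> borel_measurable equivalences_borel"
    using assms borel_measurable_integrable[of \<rho> a] by (auto simp: limit_density_def)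
  have "integrable (distr \<rho> equivalences_borel (rel_shift g)) a"
    using a by (simp add: distr_\<rho>)
  then show "integrable \<rho> (\<lambda>r. a (rel_shift g r))"
    by (rule integrable_distr[rotated]) (simp add: rel_shift_measurable measurable_cong_sets[OF sets_\<rho> refl])
  fix A :: "('g \<Rightarrow> 'g \<Rightarrow> bool) set" assume A: "A \<in> clopens"
  \<comment> \<open>\<open>B\<close> is the translate of \<open>A\<close> by \<open>g\<close>,
    written as a preimage under the inverse shift; so \<open>r\<close> lies in \<open>A\<close> iff
    \<open>rel_shift g r\<close> lies in \<open>B\<close>.\<close>
  define B where "B = rel_shift (- g) -` A \<inter> equivalences"
  have B: "B \<in> clopens"
    unfolding B_def by (rule clopens_vimage_rel_shift[OF A])
  have ind: "indicat_real A r = indicator B (rel_shift g r)" if "r \<in> equivalences" for r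
    using that rel_shift_equivalences[OF that] by (auto simp: B_def indicator_def)
  have "(\<integral>r. a (rel_shift g r) * indicator A r \<partial>\<rho>) = (\<integral>r. a (rel_shift g r) * indicator B (rel_shift g r) \<partial>\<rho>)"
    by (intro Bochner_Integration.integral_cong) (auto simp: ind)
  also have "\<dots> = (\<integral>r. a r * indicator B r \<partial>\<rho>)"
    using a(2) clopens_sets[OF B]
    by (intro integral_\<rho>_shift borel_measurable_times borel_measurable_indicator)
  finally have 1: "(\<integral>r. a (rel_shift g r) * indicator A r \<partial>\<rho>) = (\<integral>r. a r * indicator B r \<partial>\<rho>)" .
  have 2: "(\<integral>r. b (rel_shift g r) * indicator A r \<partial>\<rho>s n) = (\<integral>r. b r * indicator B r \<partial>\<rho>s n)" for n
  proof -
    have "(\<integral>r. b (rel_shift g r) * indicator A r \<partial>\<rho>s n) = (\<integral>r. b (rel_shift g r) * indicator B (rel_shift g r) \<partial>\<rho>s n)"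
      by (intro Bochner_Integration.integral_cong) (auto simp: ind)
    also have "\<dots> = (\<integral>r. b r * indicator B r \<partial>\<rho>s n)"
      using bounded_borel_clopen_mult[OF limit_density_bounded[OF assms] B]
      by (intro integral_\<rho>_shift) (auto simp: bounded_borel_def)
    finally show ?thesis .
  qed
  show "((\<lambda>n. \<integral>r. b (rel_shift g r) * indicator A r \<partial>\<rho>s n) \<longlongrightarrow> (\<integral>r. a (rel_shift g r) * indicator A r \<partial>\<rho>)) F"
    unfolding 1 2 using assms B by (simp add: limit_density_def)
qed

section \<open>Existence of limit densities\<close>

text \<open>The limits over clopen sets are finitely additive and, as \<open>b\<close> is at most 1,
  bounded by \<open>measure \<rho>\<close>. They inherit continuity at the empty set from
  \<open>\<rho>\<close>, so Caratheodory's theorem extends them to a measure.\<close>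

lemma clopen_limit_measure:
  assumes b: "bounded_borel b" "\<And>r. 0 \<le> b r" "\<And>r. b r \<le> 1"
  obtains M where "sets M = sets equivalences_borel" "finite_measure M"
    "\<And>A. A \<in> clopens \<Longrightarrow> ((\<lambda>n. \<integral>r. b r * indicator A r \<partial>\<rho>s n) \<longlongrightarrow> measure M A) F"
proof -
  interpret clopens: algebra equivalences "clopens :: ('g \<Rightarrow> 'g \<Rightarrow> bool) set set"
    by (rule algebra_clopens)
  define l where "l A = Lim F (\<lambda>n. \<integral>r. b r * indicator A r \<partial>\<rho>s n)" for A
  have l: "((\<lambda>n. \<integral>r. b r * indicator A r \<partial>\<rho>s n) \<longlongrightarrow> l A) F" if "A \<in> clopens" for A
    using integral_convergent[OF bounded_borel_clopen_mult[OF b(1) that]]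
      tendsto_Lim[OF F_nontrivial] unfolding l_def by blast
  have l_nonneg: "0 \<le> l A" if "A \<in> clopens" for A
    by (rule tendsto_lowerbound[OF l[OF that]])
      (auto intro!: always_eventually integral_nonneg_AE b(2) mult_nonneg_nonneg simp: F_nontrivial)
  have l_le: "l A \<le> measure \<rho> A" if A: "A \<in> clopens" for A
  proof (rule tendsto_le[OF F_nontrivial measure_tendsto[OF A] l[OF A]], intro always_eventually allI)
    fix n
    have "(\<integral>r. b r * indicator A r \<partial>\<rho>s n) \<le> (\<integral>r. indicator A r \<partial>\<rho>s n)"
      using b(3) bounded_borel_clopen_mult[OF b(1) A] bounded_borel_indicator[OF clopens_sets[OF A]]
      by (intro integral_mono bounded_borel_integrable)
        (auto intro: mult_left_le_one_le simp: b(2) split: split_indicator)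
    then show "(\<integral>r. b r * indicator A r \<partial>\<rho>s n) \<le> measure (\<rho>s n) A"
      using clopens_sub[OF A] by (simp add: Int_absorb2)
  qed
  have l_add: "l (A \<union> B) = l A + l B" if AB: "A \<in> clopens" "B \<in> clopens" "A \<inter> B = {}" for A B
  proof -
    have "(\<integral>r. b r * indicator (A \<union> B) r \<partial>\<rho>s n)
        = (\<integral>r. b r * indicator A r \<partial>\<rho>s n) + (\<integral>r. b r * indicator B r \<partial>\<rho>s n)" for n
    proof -
      have "b r * indicator (A \<union> B) r = b r * indicator A r + b r * indicator B r" for r
        using AB(3) by (auto simp: indicator_def)
      then show ?thesis
        using b(1) AB by (simp add: bounded_borel_integrable bounded_borel_clopen_mult)
    qed
    then have "((\<lambda>n. \<integral>r. b r * indicator (A \<union> B) r \<partial>\<rho>s n) \<longlongrightarrow> l A + l B) F"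
      using AB by (auto intro!: tendsto_add l)
    then show ?thesis
      using tendsto_unique[OF F_nontrivial l, of "A \<union> B"] AB by auto
  qed
  have "\<exists>\<mu>. (\<forall>s\<in>clopens. \<mu> s = ennreal (l s)) \<and> measure_space equivalences (sigma_sets equivalences clopens) \<mu>"
  proof (rule clopens.caratheodory_empty_continuous)
    show "positive clopens (\<lambda>A. ennreal (l A))"
      by (simp add: positive_def l_def tendsto_Lim[OF F_nontrivial tendsto_const])
    show "additive clopens (\<lambda>A. ennreal (l A))"
      by (auto simp: additive_def l_add l_nonneg)
    fix A :: "nat \<Rightarrow> ('g \<Rightarrow> 'g \<Rightarrow> bool) set"
    assume A: "range A \<subseteq> clopens" "decseq A" "(\<Inter>i. A i) = {}"
    then have "range A \<subseteq> sets \<rho>" using clopens_sets by auto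
    then have "(\<lambda>i. measure \<rho> (A i)) \<longlonglongrightarrow> 0"
      using \<rho>.finite_Lim_measure_decseq[of A] A by simp
    then have "(\<lambda>i. l (A i)) \<longlonglongrightarrow> 0"
      by (rule tendsto_sandwich[OF _ _ tendsto_const, rotated 2])
        (use A in \<open>auto intro!: always_eventually l_nonneg l_le\<close>)
    then show "(\<lambda>i. ennreal (l (A i))) \<longlonglongrightarrow> 0"
      using tendsto_ennrealI by fastforce
  qed auto
  then obtain \<mu> where \<mu>: "\<And>A. A \<in> clopens \<Longrightarrow> \<mu> A = ennreal (l A)"
    "measure_space equivalences (sigma_sets equivalences clopens) \<mu>" by blast
  define M where "M = measure_of equivalences clopens \<mu>"
  have sets_M: "sets M = sigma_sets equivalences clopens"
    unfolding M_def by (rule sets_measure_of[OF clopens_Pow])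
  have em: "emeasure M A = ennreal (l A)" if "A \<in> clopens" for A
    using emeasure_measure_of[OF M_def clopens_Pow, of A] \<mu> that
    by (auto simp: sets_M measure_space_def)
  show ?thesis
  proof (rule that)
    show "sets M = sets equivalences_borel"
      by (simp add: sets_M sets_equivalences_borel)
    then have "space M = equivalences" by (auto dest: sets_eq_imp_space_eq)
    then show "finite_measure M"
      by (intro finite_measureI) (simp add: em)
    fix A :: "('g \<Rightarrow> 'g \<Rightarrow> bool) set" assume "A \<in> clopens"
    then show "((\<lambda>n. \<integral>r. b r * indicator A r \<partial>\<rho>s n) \<longlongrightarrow> measure M A) F"
      using l[of A] by (simp add: measure_def em l_nonneg)
  qed
qed

text \<open>
  Only clopen sets are compared with \<open>\<rho>\<close>, so absolute continuity of the limit measure for \<open>b\<close> is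
  obtained from the fact that it and the one for \<open>1 - b\<close> add up to \<open>\<rho>\<close>.
\<close>

lemma limit_density_exists_01:
  assumes b: "bounded_borel b" "\<And>r. 0 \<le> b r" "\<And>r. b r \<le> 1"
  shows "\<exists>a. limit_density b a \<and> (\<forall>r. 0 \<le> a r)"
proof -
  obtain M where M: "sets M = sets equivalences_borel" "finite_measure M"
    "\<And>A. A \<in> clopens \<Longrightarrow> ((\<lambda>n. \<integral>r. b r * indicator A r \<partial>\<rho>s n) \<longlongrightarrow> measure M A) F"
    using b by (rule clopen_limit_measure) blast
  obtain M' where M': "sets M' = sets equivalences_borel" "finite_measure M'"
    "\<And>A. A \<in> clopens \<Longrightarrow> ((\<lambda>n. \<integral>r. (1 - b r) * indicator A r \<partial>\<rho>s n) \<longlongrightarrow> measure M' A) F"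
    by (rule clopen_limit_measure[of "\<lambda>r. 1 - b r"]) (use b in \<open>auto intro: bounded_borel_diff\<close>)
  interpret M: finite_measure M by fact
  have M_le: "measure M A \<le> measure \<rho> A" if "A \<in> sets equivalences_borel" for A
  proof (rule measure_le_of_clopens_complement[OF M(1) M'(1) sets_\<rho> M(2) M'(2) \<rho>.finite_measure_axioms _ that])
    fix A :: "('g \<Rightarrow> 'g \<Rightarrow> bool) set" assume A: "A \<in> clopens"
    have "(\<integral>r. b r * indicator A r \<partial>\<rho>s n) + (\<integral>r. (1 - b r) * indicator A r \<partial>\<rho>s n) = measure (\<rho>s n) A" for n
    proof -
      have "bounded_borel (\<lambda>r. (1 - b r) * indicator A r)"
        using A b(1) by (intro bounded_borel_clopen_mult bounded_borel_diff) auto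
      then have "(\<integral>r. b r * indicator A r \<partial>\<rho>s n) + (\<integral>r. (1 - b r) * indicator A r \<partial>\<rho>s n)
          = (\<integral>r. b r * indicator A r + (1 - b r) * indicator A r \<partial>\<rho>s n)"
        using A b(1) by (intro Bochner_Integration.integral_add[symmetric])
          (auto intro: bounded_borel_integrable bounded_borel_clopen_mult)
      also have "\<dots> = (\<integral>r. indicator A r \<partial>\<rho>s n)"
        by (simp add: algebra_simps)
      also have "\<dots> = measure (\<rho>s n) A" using clopens_sub[OF A] by (simp add: Int_absorb2)
      finally show ?thesis .
    qed
    then have "((\<lambda>n. measure (\<rho>s n) A) \<longlongrightarrow> measure M A + measure M' A) F"
      using tendsto_add[OF M(3)[OF A] M'(3)[OF A]] by simp
    then show "measure M A + measure M' A = measure \<rho> A"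
      using tendsto_unique[OF F_nontrivial _ measure_tendsto[OF A]] by blast
  qed
  have ac: "absolutely_continuous \<rho> M"
    unfolding absolutely_continuous_def
  proof
    fix A assume A: "A \<in> null_sets \<rho>"
    then have "measure M A \<le> 0"
      using M_le[of A] by (auto simp: null_sets_def measure_def)
    then have "measure M A = 0"
      by (simp add: measure_le_0_iff)
    then show "A \<in> null_sets M"
      using A by (auto simp: M(1) M.emeasure_eq_measure null_sets_def)
  qed
  \<comment> \<open>A real version of the Radon-Nikodym derivative, nonnegative at every point as
    the second conjunct of the claim demands.\<close>
  obtain D where D: "D \<in> borel_measurable \<rho>" "AE r in \<rho>. RN_deriv \<rho> M r = ennreal (D r)" "\<And>r. 0 \<le> D r"
    using \<rho>.real_RN_deriv[OF M(2) ac] M(1) by (metis sets_\<rho>)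
  have D_nn: "(\<integral>\<^sup>+r. ennreal (D r * indicator A r) \<partial>\<rho>) = ennreal (measure M A)" if A: "A \<in> sets equivalences_borel" for A
  proof -
    have "(\<integral>\<^sup>+r. ennreal (D r * indicator A r) \<partial>\<rho>) = (\<integral>\<^sup>+r. RN_deriv \<rho> M r * indicator A r \<partial>\<rho>)"
      using D(2) by (intro nn_integral_cong_AE) (auto simp: indicator_def)
    also have "\<dots> = emeasure (density \<rho> (RN_deriv \<rho> M)) A"
      using A by (intro emeasure_density[symmetric]) auto
    also have "density \<rho> (RN_deriv \<rho> M) = M"
      using ac M(1) by (intro \<rho>.density_RN_deriv) auto
    finally show ?thesis by (simp add: M.emeasure_eq_measure)
  qed
  have int: "integrable \<rho> (\<lambda>r. D r * indicator A r)" "(\<integral>r. D r * indicator A r \<partial>\<rho>) = measure M A"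
    if A: "A \<in> sets equivalences_borel" for A
  proof -
    have DA: "(\<lambda>r. D r * indicator A r) \<in> borel_measurable \<rho>"
      using D(1) A by (intro borel_measurable_times borel_measurable_indicator) auto
    show "integrable \<rho> (\<lambda>r. D r * indicator A r)"
      using DA D(3) D_nn[OF A] by (intro integrableI_nonneg) auto
    show "(\<integral>r. D r * indicator A r \<partial>\<rho>) = measure M A"
      using DA D(3) D_nn[OF A] by (subst integral_eq_nn_integral) auto
  qed
  have "limit_density b D"
    unfolding limit_density_def
  proof (intro conjI ballI)
    have "integrable \<rho> (\<lambda>r. D r * indicator equivalences r)"
      using int(1)[of equivalences] sets.top[of "equivalences_borel :: ('g \<Rightarrow> 'g \<Rightarrow> bool) measure"] by simp
    then show "integrable \<rho> D"
      by (rule Bochner_Integration.integrable_cong[OF refl, THEN iffD1, rotated]) auto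
  qed (use b M(3) in \<open>auto simp: int clopens_sets\<close>)
  then show ?thesis using D(3) by blast
qed

text \<open>The map \<open>t \<mapsto> (t + C) / (2 * C)\<close> carries \<open>[-C, C]\<close> onto
  \<open>[0, 1]\<close>, where existence is known, and linearity undoes it. The summand 1 in
  \<open>C\<close> keeps the divisor positive even if \<open>K = 0\<close>.\<close>

lemma limit_density_exists:
  assumes "bounded_borel b"
  shows "\<exists>a. limit_density b a"
proof -
  obtain K where K: "\<And>r. \<bar>b r\<bar> \<le> K" using assms by (auto simp: bounded_borel_def)
  define C where "C = \<bar>K\<bar> + 1"
  have C: "C > 0" by (simp add: C_def)
  have C': "\<bar>b r\<bar> \<le> C" for r using K[of r] by (simp add: C_def)
  have "bounded_borel (\<lambda>r. 1 / (2 * C) * (b r + C))"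
    by (intro bounded_borel_mult bounded_borel_add assms) auto
  moreover have "0 \<le> 1 / (2 * C) * (b r + C)" "1 / (2 * C) * (b r + C) \<le> 1" for r
    using C C'[of r] by (auto simp: divide_simps)
  ultimately obtain a where "limit_density (\<lambda>r. 1 / (2 * C) * (b r + C)) a"
    using limit_density_exists_01 by blast
  then have "limit_density (\<lambda>r. 2 * C * (1 / (2 * C) * (b r + C)) - C) (\<lambda>r. 2 * C * a r - C)"
    by (intro limit_density_diff limit_density_cmult limit_density_const)
  moreover have "(\<lambda>r. 2 * C * (1 / (2 * C) * (b r + C)) - C) = b"
    using C by auto
  ultimately show ?thesis by auto
qed

section \<open>Order properties of limit densities\<close>

text \<open>The rescaled positive part of \<open>b\<close> has an everywhere nonnegative density by
  \<open>limit_density_exists_01\<close>. The positive part equals \<open>b\<close> almost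
  everywhere for each \<open>\<rho>s n\<close>, so uniqueness of densities transfers the sign to
  \<open>a\<close>.\<close>

lemma limit_density_nonneg:
  assumes "limit_density b a" "\<And>n. AE r in \<rho>s n. 0 \<le> b r"
  shows "AE r in \<rho>. 0 \<le> a r"
proof -
  obtain K where K: "b \<in> borel_measurable equivalences_borel" "\<And>r. \<bar>b r\<bar> \<le> K"
    using limit_density_bounded[OF assms(1)] by (auto simp: bounded_borel_def)
  define C where "C = \<bar>K\<bar> + 1"
  have C: "C > 0" by (simp add: C_def)
  have C': "b r \<le> C" for r using K(2)[of r] by (simp add: C_def)
  let ?c = "\<lambda>r. 1 / C * max 0 (b r)"
  have range: "0 \<le> ?c r" "?c r \<le> 1" for r using C C'[of r] by (auto simp: divide_simps)
  moreover have "bounded_borel ?c"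
    by (rule bounded_borelI[of _ 1]) (use K(1) range in \<open>auto simp: C\<close>)
  ultimately obtain a' where a': "limit_density ?c a'" "\<And>r. 0 \<le> a' r"
    using limit_density_exists_01[of ?c] by blast
  then have "limit_density (\<lambda>r. C * ?c r) (\<lambda>r. C * a' r)"
    by (intro limit_density_cmult)
  then have "limit_density b (\<lambda>r. C * a' r)"
  proof (rule limit_density_cong)
    show "AE r in \<rho>s n. C * ?c r = b r" for n
      using assms(2)[of n] by eventually_elim (use C in auto)
  qed (rule limit_density_bounded[OF assms(1)])
  with assms(1) have "AE r in \<rho>. a r = C * a' r"
    by (rule limit_density_unique)
  then show ?thesis
    by eventually_elim (use a'(2) C in auto)
qed

lemma limit_density_mono:
  assumes "limit_density b a" "limit_density b' a'" "\<And>n. AE r in \<rho>s n. b r \<le> b' r"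
  shows "AE r in \<rho>. a r \<le> a' r"
  using limit_density_nonneg[OF limit_density_diff[OF assms(2,1)]] assms(3) by simp

text \<open>Both \<open>b\<close> and \<open>- b\<close> lie below the absolute value. Only an
  inequality is claimed, as contributions of opposite sign may cancel in the limit.\<close>

lemma limit_density_abs:
  assumes "limit_density b a" "limit_density (\<lambda>r. \<bar>b r\<bar>) a'"
  shows "AE r in \<rho>. \<bar>a r\<bar> \<le> a' r"
proof -
  have "AE r in \<rho>. a r \<le> a' r"
    by (rule limit_density_mono[OF assms]) auto
  moreover have "AE r in \<rho>. - 1 * a r \<le> a' r"
    by (rule limit_density_mono[OF limit_density_cmult[OF assms(1)] assms(2)]) auto
  ultimately show ?thesis by eventually_elim auto
qed

end

section \<open>Averages over finite classes\<close>

text \<open>The hypotheses involve only finite sets and the thresholds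
  \<open>1 / real (Suc m)\<close>; over a countable type these are countably many conditions, which
  can hold together off one null set. The conclusion is in the form required for
  \<open>embed_pmf\<close>.\<close>

lemma nn_integral_count_space_eq_1I:
  fixes f :: "'a \<Rightarrow> real"
  assumes nonneg: "\<And>x. 0 \<le> f x"
    and le: "\<And>S. finite S \<Longrightarrow> sum f S \<le> 1"
    and ge: "\<And>m :: nat. \<exists>S. finite S \<and> 1 - 1 / real (Suc m) \<le> sum f S"
  shows "(\<integral>\<^sup>+x. ennreal (f x) \<partial>count_space UNIV) = 1"
proof -
  have s: "f summable_on UNIV"
    using nonneg le by (intro nonneg_bdd_above_summable_on bdd_aboveI[of _ 1]) auto
  have "infsum f UNIV = 1"
  proof (rule antisym)
    show "infsum f UNIV \<le> 1"
      by (intro infsum_le_finite_sums s le)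
    have "1 - 1 / real (Suc m) \<le> infsum f UNIV" for m
      using ge[of m] finite_sum_le_infsum[OF s] nonneg by (meson UNIV_I order_trans subset_UNIV)
    moreover have "(\<lambda>m. 1 - 1 / real (Suc m)) \<longlonglongrightarrow> 1 - 0"
      by (intro tendsto_diff tendsto_const LIMSEQ_Suc[OF lim_1_over_n])
    ultimately show "1 \<le> infsum f UNIV"
      by (intro LIMSEQ_le_const2[of "\<lambda>m. 1 - 1 / real (Suc m)" 1]) auto
  qed
  moreover have abs: "Infinite_Set_Sum.abs_summable_on f UNIV"
    using abs_summable_equivalent[THEN iffD1, OF summable_on_iff_abs_summable_on_real[THEN iffD1, OF s]] .
  ultimately show ?thesis
    using nn_integral_conv_infsetsum[OF abs] infsetsum_infsum[OF abs] nonneg by simp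
qed

text \<open>For an infinite class the sum and the cardinality are both 0 and the value is 0, so the
  bounds by 0 and 1 hold for every \<open>r\<close>.\<close>

definition class_average :: "('g::zero \<Rightarrow> 'g pmf) \<Rightarrow> 'g \<Rightarrow> ('g \<Rightarrow> 'g \<Rightarrow> bool) \<Rightarrow> real" where
  "class_average q h r = (\<Sum>c\<in>rel_class r 0. pmf (q c) h) / card (rel_class r 0)"

lemma class_average_nonneg: "0 \<le> class_average q h r"
  by (simp add: class_average_def sum_nonneg)

lemma class_average_le_1: "class_average q h r \<le> 1"
proof (cases "card (rel_class r 0) = 0")
  case False
  have "(\<Sum>c\<in>rel_class r 0. pmf (q c) h) \<le> (\<Sum>c\<in>rel_class r 0. 1)"
    by (intro sum_mono pmf_le_1)
  then show ?thesis
    using False by (simp add: class_average_def divide_simps)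
qed (simp add: class_average_def)

lemma sum_class_average:
  "(\<Sum>h\<in>S. class_average q h r) = (\<Sum>c\<in>rel_class r 0. sum (pmf (q c)) S) / card (rel_class r 0)"
  unfolding class_average_def sum_divide_distrib[symmetric] by (subst sum.swap) simp

lemma pred_rel [measurable]: "Measurable.pred equivalences_borel (\<lambda>r. r a b)"
  using clopens_sets[OF rel_clopen[of a b]] by (simp add: pred_def)

text \<open>A countable type has only countably many finite subsets, so the average factors through
  a measurable map \<open>cl\<close> into a countable space. Infinite classes are sent to
  \<open>{}\<close>, which matches the default value 0.\<close>

lemma bounded_borel_class_average:
  fixes q :: "'g::{zero, countable} \<Rightarrow> 'g pmf"
  shows "bounded_borel (class_average q h)"
proof (rule bounded_borelI)
  let ?N = "equivalences_borel :: ('g \<Rightarrow> 'g \<Rightarrow> bool) measure"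
  define cl where "cl r = (if finite (rel_class r 0) then rel_class r 0 else {})" for r :: "'g \<Rightarrow> 'g \<Rightarrow> bool"
  have eq [measurable]: "Measurable.pred ?N (\<lambda>r. rel_class r 0 = C)" for C
    unfolding set_eq_iff rel_class_def mem_Collect_eq by measurable
  have fin [measurable]: "Measurable.pred ?N (\<lambda>r. finite (rel_class r 0))"
  proof -
    \<comment> \<open>Lists over \<open>'g\<close> form a countable type, so the quantifier is a
      countable union of measurable events.\<close>
    have "Measurable.pred ?N (\<lambda>r. \<exists>xs. rel_class r 0 = set xs)" by measurable
    moreover have "finite C \<longleftrightarrow> (\<exists>xs. C = set xs)" for C :: "'g set"
      by (auto dest: finite_list)
    ultimately show ?thesis by simp
  qed
  have cl: "cl \<in> measurable ?N (count_space (Collect finite))"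
  proof (subst measurable_count_space_eq_countable, intro countable_Collect_finite, intro conjI ballI)
    fix C :: "'g set"
    have "cl r = C \<longleftrightarrow> (if finite (rel_class r 0) then rel_class r 0 = C else C = {})" for r
      by (auto simp: cl_def)
    then have "cl -` {C} \<inter> space ?N
        = {r \<in> space ?N. if finite (rel_class r 0) then rel_class r 0 = C else C = {}}"
      by blast
    also have "\<dots> \<in> sets ?N" by measurable
    finally show "cl -` {C} \<inter> space ?N \<in> sets ?N" .
  qed (auto simp: cl_def)
  have "(\<lambda>r. (\<Sum>c\<in>cl r. pmf (q c) h) / card (cl r)) \<in> borel_measurable ?N"
    by (rule measurable_compose_countable'[OF _ cl countable_Collect_finite]) simp
  moreover have "class_average q h r = (\<Sum>c\<in>cl r. pmf (q c) h) / card (cl r)" for r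
    by (simp add: class_average_def cl_def)
  ultimately show "class_average q h \<in> borel_measurable ?N"
    by (simp cong: measurable_cong)
  show "\<bar>class_average q h r\<bar> \<le> 1" for r
    using class_average_nonneg[of q h r] class_average_le_1[of q h r] by simp
qed

text \<open>The class of \<open>0\<close> in the relation shifted by \<open>- g\<close> is the
  translate by \<open>- g\<close> of the class of \<open>g\<close> in \<open>r\<close>, and the
  latter is the class of \<open>0\<close> because \<open>r 0 g\<close>.\<close>

lemma class_average_shift:
  fixes q :: "'g::group_add \<Rightarrow> 'g pmf"
  assumes r: "r \<in> equivalences" "r 0 g"
  shows "class_average q h (rel_shift (- g) r)
    = (\<Sum>c\<in>rel_class r 0. pmf (q (- g + c)) h) / card (rel_class r 0)"
proof -
  have "r g c \<longleftrightarrow> r 0 c" for c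
    using r by (metis equivalences_def equivp_symp equivp_transp mem_Collect_eq)
  then have *: "h \<in> rel_class (rel_shift (- g) r) 0 \<longleftrightarrow> g + h \<in> rel_class r 0" for h
    by (simp add: rel_class_def rel_shift_def)
  have eq: "rel_class (rel_shift (- g) r) 0 = (\<lambda>c. - g + c) ` rel_class r 0"
  proof (intro set_eqI iffI)
    fix h assume "h \<in> rel_class (rel_shift (- g) r) 0"
    then show "h \<in> (\<lambda>c. - g + c) ` rel_class r 0"
      by (intro image_eqI[of _ _ "g + h"]) (simp_all add: * add.assoc[symmetric])
  next
    fix h assume "h \<in> (\<lambda>c. - g + c) ` rel_class r 0"
    then show "h \<in> rel_class (rel_shift (- g) r) 0"
      by (auto simp: * add.assoc[symmetric])
  qed
  have inj: "inj_on (\<lambda>c. - g + c) (rel_class r 0)"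
    by (auto simp: inj_on_def)
  show ?thesis
    unfolding class_average_def eq by (simp add: sum.reindex[OF inj] card_image[OF inj])
qed

text \<open>After reindexing, both averages run over one class with the same normalisation. Their
  difference is an average of differences of norm at most \<open>d\<close>, so the bound does not
  depend on the size of the class.\<close>

lemma class_average_almost_equivariant:
  fixes q :: "'g::group_add \<Rightarrow> 'g pmf"
  assumes r: "r \<in> equivalences" "r 0 g" "finite (rel_class r 0)"
    and q: "\<And>c. dist (pmf_shift (- g) (q c)) (q (- g + c)) \<le> d"
    and S: "finite S"
  shows "(\<Sum>h\<in>S. \<bar>class_average q (g + h) r - class_average q h (rel_shift (- g) r)\<bar>) \<le> d"
proof -
  let ?C = "rel_class r 0"
  have C: "card ?C > 0"
    using r by (auto simp: card_gt_0_iff rel_class_def)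
  have "\<bar>class_average q (g + h) r - class_average q h (rel_shift (- g) r)\<bar>
      = \<bar>\<Sum>c\<in>?C. pmf (q c) (g + h) - pmf (q (- g + c)) h\<bar> / card ?C" for h
    unfolding class_average_shift[OF r(1,2)] unfolding class_average_def
    by (simp only: diff_divide_distrib[symmetric] sum_subtractf abs_divide abs_of_nat)
  then have "(\<Sum>h\<in>S. \<bar>class_average q (g + h) r - class_average q h (rel_shift (- g) r)\<bar>)
      = (\<Sum>h\<in>S. \<bar>\<Sum>c\<in>?C. pmf (q c) (g + h) - pmf (q (- g + c)) h\<bar> / card ?C)"
    by (simp only:)
  also have "\<dots> \<le> (\<Sum>h\<in>S. (\<Sum>c\<in>?C. \<bar>pmf (q c) (g + h) - pmf (q (- g + c)) h\<bar>) / card ?C)"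
    by (intro sum_mono divide_right_mono sum_abs) auto
  also have "\<dots> = (\<Sum>c\<in>?C. \<Sum>h\<in>S. \<bar>pmf (pmf_shift (- g) (q c)) h - pmf (q (- g + c)) h\<bar>) / card ?C"
    unfolding sum_divide_distrib[symmetric] pmf_pmf_shift minus_minus by (subst sum.swap) (rule refl)
  also have "\<dots> \<le> (\<Sum>c\<in>?C. d) / card ?C"
    by (intro divide_right_mono sum_mono order_trans[OF sum_pmf_diff_le_dist[OF S] q]) auto
  also have "\<dots> = d" using C by simp
  finally show ?thesis .
qed

section \<open>Amenability of the limit\<close>

context IRE_limit
begin

text \<open>Finite-sum inequalities hold for the averages almost everywhere under each
  \<open>\<rho>s n\<close>; \<open>limit_density_mono\<close> passes them to the densities one at a
  time, and countability of \<Gamma> collects the exceptional null sets. Total mass 1 is recovered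
  from tightness, as no infinite sum is taken to the limit.\<close>

lemma limit_kernels:
  fixes q :: "nat \<Rightarrow> 'g \<Rightarrow> 'g pmf" and \<delta> :: "'g \<Rightarrow> nat \<Rightarrow> real"
  assumes fin: "\<And>n. AE r in \<rho>s n. \<forall>g. finite (rel_class r g)"
    and tight: "\<And>k m. \<exists>S. finite S \<and> (\<forall>c. sum (pmf (q k c)) S > 1 - 1 / real (Suc m))"
    and dist: "\<And>g k c. dist (pmf_shift g (q k c)) (q k (g + c)) \<le> \<delta> g k"
  obtains a :: "nat \<Rightarrow> 'g \<Rightarrow> ('g \<Rightarrow> 'g \<Rightarrow> bool) \<Rightarrow> real"
  where "\<And>k h. a k h \<in> borel_measurable equivalences_borel"
    and "AE r in \<rho>. \<forall>k. (\<forall>h. 0 \<le> a k h r) \<and> (\<integral>\<^sup>+h. ennreal (a k h r) \<partial>count_space UNIV) = 1"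
    and "AE r in \<rho>. \<forall>k g. r 0 g \<longrightarrow>
      (\<forall>S\<in>Collect finite. (\<Sum>h\<in>S. \<bar>a k (g + h) r - a k h (rel_shift (- g) r)\<bar>) \<le> \<delta> (- g) k)"
proof -
  define a where "a k h = (SOME f. limit_density (class_average (q k) h) f)" for k h
  have a: "limit_density (class_average (q k) h) (a k h)" for k h
    unfolding a_def by (rule someI_ex[OF limit_density_exists[OF bounded_borel_class_average]])
  have fin0: "AE r in \<rho>s n. r \<in> equivalences \<and> finite (rel_class r 0)" for n
    using fin[of n] AE_space[of "\<rho>s n"] by eventually_elim auto
  have class_pos: "card (rel_class r 0) > 0" if "r \<in> equivalences" "finite (rel_class r 0)" for r :: "'g \<Rightarrow> 'g \<Rightarrow> bool"
    using that by (auto simp: card_gt_0_iff rel_class_def equivalences_def dest: equivp_reflp)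
  show ?thesis
  proof (rule that)
    show "a k h \<in> borel_measurable equivalences_borel" for k h
      using a[of k h] borel_measurable_integrable[of \<rho> "a k h"] by (simp add: limit_density_def)
    have a_sum: "limit_density (\<lambda>r. \<Sum>h\<in>S. class_average (q k) h r) (\<lambda>r. \<Sum>h\<in>S. a k h r)" for k S
      by (rule limit_density_sum) (rule a)
    have nonneg: "AE r in \<rho>. 0 \<le> a k h r" for k h
      by (rule limit_density_nonneg[OF a]) (simp add: class_average_nonneg)
    have le: "AE r in \<rho>. (\<Sum>h\<in>S. a k h r) \<le> 1" if "finite S" for k S
    proof (rule limit_density_mono[OF a_sum limit_density_const])
      show "AE r in \<rho>s n. (\<Sum>h\<in>S. class_average (q k) h r) \<le> 1" for n
        using fin0[of n]
      proof eventually_elim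
        case (elim r)
        have "(\<Sum>c\<in>rel_class r 0. sum (pmf (q k c)) S) \<le> (\<Sum>c\<in>rel_class r 0. 1)"
          by (intro sum_mono sum_pmf_le_1 that)
        moreover have "real (card (rel_class r 0)) > 0"
          using class_pos[of r] elim by (simp only: of_nat_0_less_iff)
        ultimately show ?case
          by (simp add: sum_class_average)
      qed
    qed
    \<comment> \<open>No mass escapes: the same finite \<open>S\<close> serves all \<open>c\<close>,
      hence every finite class and every \<open>n\<close>.\<close>
    have ge: "AE r in \<rho>. \<exists>S. finite S \<and> 1 - 1 / real (Suc m) \<le> (\<Sum>h\<in>S. a k h r)" for k m
    proof -
      obtain S where "finite S \<and> (\<forall>c. sum (pmf (q k c)) S > 1 - 1 / real (Suc m))"
        using tight[of m k] by (rule exE)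
      then have S: "finite S" "\<And>c. sum (pmf (q k c)) S > 1 - 1 / real (Suc m)" by simp_all
      have "AE r in \<rho>. 1 - 1 / real (Suc m) \<le> (\<Sum>h\<in>S. a k h r)"
      proof (rule limit_density_mono[OF limit_density_const a_sum])
        show "AE r in \<rho>s n. 1 - 1 / real (Suc m) \<le> (\<Sum>h\<in>S. class_average (q k) h r)" for n
          using fin0[of n]
        proof eventually_elim
          case (elim r)
          have "real (card (rel_class r 0)) * (1 - 1 / real (Suc m)) \<le> (\<Sum>c\<in>rel_class r 0. sum (pmf (q k c)) S)"
            by (rule sum_bounded_below) (rule less_imp_le[OF S(2)])
          moreover have "real (card (rel_class r 0)) > 0"
            using class_pos[of r] elim by (simp only: of_nat_0_less_iff)
          ultimately show ?case
            unfolding sum_class_average by (subst pos_le_divide_eq) (simp_all only: mult.commute)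
        qed
      qed
      then show ?thesis
        by eventually_elim (rule exI[of _ S], rule conjI[OF S(1)])
    qed
    have "AE r in \<rho>. \<forall>k h. 0 \<le> a k h r"
      unfolding AE_all_countable using nonneg by blast
    moreover have "AE r in \<rho>. \<forall>k. \<forall>S\<in>Collect finite. (\<Sum>h\<in>S. a k h r) \<le> 1"
      unfolding AE_all_countable AE_ball_countable[OF countable_Collect_finite] using le by blast
    moreover have "AE r in \<rho>. \<forall>k m. \<exists>S. finite S \<and> 1 - 1 / real (Suc m) \<le> (\<Sum>h\<in>S. a k h r)"
      unfolding AE_all_countable by (intro allI ge)
    ultimately show "AE r in \<rho>. \<forall>k. (\<forall>h. 0 \<le> a k h r) \<and> (\<integral>\<^sup>+h. ennreal (a k h r) \<partial>count_space UNIV) = 1"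
    proof eventually_elim
      case (elim r)
      show ?case
      proof (intro allI conjI)
        fix k
        show "(\<integral>\<^sup>+h. ennreal (a k h r) \<partial>count_space UNIV) = 1"
        proof (rule nn_integral_count_space_eq_1I)
          show "\<exists>S. finite S \<and> 1 - 1 / real (Suc m) \<le> (\<Sum>h\<in>S. a k h r)" for m
            by (rule elim(3)[rule_format])
        qed (use elim(1,2) in simp_all)
      qed (rule elim(1)[rule_format])
    qed
    have "AE r in \<rho>. r 0 g \<longrightarrow> (\<Sum>h\<in>S. \<bar>a k (g + h) r - a k h (rel_shift (- g) r)\<bar>) \<le> \<delta> (- g) k"
      if S: "finite S" for k g S
    proof -
      let ?A = "{r \<in> equivalences. r 0 g}"
      \<comment> \<open>The indicator discards the relations without \<open>r 0 g\<close>, to which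
        the estimate for the averages does not apply. Since \<open>?A\<close> is clopen,
        \<open>?w h\<close> is still a limit density of \<open>?u h\<close>.\<close>
      let ?u = "\<lambda>h r. (class_average (q k) (g + h) r - class_average (q k) h (rel_shift (- g) r)) * indicator ?A r"
      let ?w = "\<lambda>h r. (a k (g + h) r - a k h (rel_shift (- g) r)) * indicator ?A r"
      have u: "limit_density (?u h) (?w h)" for h
        by (intro limit_density_indicator limit_density_diff limit_density_shift a rel_clopen)
      \<comment> \<open>The absolute value of \<open>?w h\<close> need not be a density for that of
        \<open>?u h\<close>; a separate density is chosen, which dominates it by
        \<open>limit_density_abs\<close>.\<close>
      define v where "v h = (SOME f. limit_density (\<lambda>r. \<bar>?u h r\<bar>) f)" for h
      have v: "limit_density (\<lambda>r. \<bar>?u h r\<bar>) (v h)" for h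
        unfolding v_def
        by (rule someI_ex[OF limit_density_exists[OF bounded_borel_abs[OF limit_density_bounded[OF u]]]])
      have d: "dist (pmf_shift (- g) (q k c)) (q k (- g + c)) \<le> \<delta> (- g) k" for c
        by (rule dist)
      \<comment> \<open>Covers the case where \<open>r 0 g\<close> fails: the sum vanishes there and
        must still obey the bound.\<close>
      have "0 \<le> \<delta> (- g) k"
        by (rule order_trans[OF zero_le_dist dist[of "- g" k 0]])
      have v_sum: "limit_density (\<lambda>r. \<Sum>h\<in>S. \<bar>?u h r\<bar>) (\<lambda>r. \<Sum>h\<in>S. v h r)"
        by (rule limit_density_sum) (rule v)
      have "AE r in \<rho>. (\<Sum>h\<in>S. v h r) \<le> \<delta> (- g) k"
      proof (rule limit_density_mono[OF v_sum limit_density_const])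
        show "AE r in \<rho>s n. (\<Sum>h\<in>S. \<bar>?u h r\<bar>) \<le> \<delta> (- g) k" for n
          using fin0[of n]
        proof eventually_elim
          case (elim r)
          then show ?case
            using class_average_almost_equivariant[of r g "q k" "\<delta> (- g) k" S, OF _ _ _ d S] \<open>0 \<le> \<delta> (- g) k\<close>
            by (cases "r 0 g") (auto simp: abs_mult)
        qed
      qed
      moreover have "AE r in \<rho>. \<forall>h. \<bar>?w h r\<bar> \<le> v h r"
        using limit_density_abs[OF u v] by (simp add: AE_all_countable)
      ultimately show ?thesis
        using AE_space
      proof eventually_elim
        case (elim r)
        show ?case
        proof
          assume "r 0 g"
          then have "(\<Sum>h\<in>S. \<bar>a k (g + h) r - a k h (rel_shift (- g) r)\<bar>) \<le> (\<Sum>h\<in>S. v h r)"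
            using elim by (intro sum_mono) (auto simp: abs_mult)
          then show "(\<Sum>h\<in>S. \<bar>a k (g + h) r - a k h (rel_shift (- g) r)\<bar>) \<le> \<delta> (- g) k"
            using elim by simp
        qed
      qed
    qed
    then have "AE r in \<rho>. \<forall>k g. \<forall>S\<in>Collect finite. r 0 g \<longrightarrow>
      (\<Sum>h\<in>S. \<bar>a k (g + h) r - a k h (rel_shift (- g) r)\<bar>) \<le> \<delta> (- g) k"
      unfolding AE_all_countable AE_ball_countable[OF countable_Collect_finite] by blast
    then show "AE r in \<rho>. \<forall>k g. r 0 g \<longrightarrow>
      (\<forall>S\<in>Collect finite. (\<Sum>h\<in>S. \<bar>a k (g + h) r - a k h (rel_shift (- g) r)\<bar>) \<le> \<delta> (- g) k)"
      by eventually_elim blast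
  qed
qed

text \<open>Invariance of \<open>\<rho>\<close> makes the preimage of a null set under the shift
  null. As \<open>P\<close> need not be measurable, the argument passes through a measurable null
  set \<open>N\<close> containing all failures.\<close>

lemma AE_shift:
  assumes "AE r in \<rho>. P r"
  shows "AE r in \<rho>. P (rel_shift g r)"
proof -
  obtain N where N: "\<And>r. r \<in> space \<rho> - N \<Longrightarrow> P r" "N \<in> null_sets \<rho>"
    using AE_E3[OF assms] by blast
  have "AE r in distr \<rho> equivalences_borel (rel_shift g). r \<notin> N"
    unfolding distr_\<rho> by (rule AE_not_in[OF N(2)])
  then have "AE r in \<rho>. rel_shift g r \<notin> N"
  proof (subst (asm) AE_distr_iff)
    show "rel_shift g \<in> measurable \<rho> equivalences_borel"
      by (simp add: rel_shift_measurable measurable_cong_sets[OF sets_\<rho> refl])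
    show "{r \<in> space equivalences_borel. r \<notin> N} \<in> sets equivalences_borel"
      using N(2) sets.compl_sets[of N equivalences_borel]
      by (simp add: null_sets_def set_diff_eq)
  qed
  then show ?thesis
    using AE_space
  proof eventually_elim
    case (elim r)
    then show ?case by (intro N(1)) (simp add: rel_shift_equivalences)
  qed
qed

lemma amenable_limit:
  fixes q :: "nat \<Rightarrow> 'g \<Rightarrow> 'g pmf" and \<delta> :: "'g \<Rightarrow> nat \<Rightarrow> real"
  assumes fin: "\<And>n. AE r in \<rho>s n. \<forall>g. finite (rel_class r g)"
    and tight: "\<And>k m. \<exists>S. finite S \<and> (\<forall>c. sum (pmf (q k c)) S > 1 - 1 / real (Suc m))"
    and dist: "\<And>g k c. dist (pmf_shift g (q k c)) (q k (g + c)) \<le> \<delta> g k"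
    and \<delta>: "\<And>g. \<delta> g \<longlonglongrightarrow> 0"
  shows "amenable_IRE \<rho>"
proof -
  obtain a where a: "\<And>k h. a k h \<in> borel_measurable equivalences_borel"
    "AE r in \<rho>. \<forall>k. (\<forall>h. 0 \<le> a k h r) \<and> (\<integral>\<^sup>+h. ennreal (a k h r) \<partial>count_space UNIV) = 1"
    "AE r in \<rho>. \<forall>k g. r 0 g \<longrightarrow>
      (\<forall>S\<in>Collect finite. (\<Sum>h\<in>S. \<bar>a k (g + h) r - a k h (rel_shift (- g) r)\<bar>) \<le> \<delta> (- g) k)"
    by (rule limit_kernels[OF fin tight dist]) (rule that)
  obtain N where N: "N \<in> null_sets \<rho>"
    "\<And>r k h. r \<in> space \<rho> - N \<Longrightarrow> 0 \<le> a k h r"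
    "\<And>r k. r \<in> space \<rho> - N \<Longrightarrow> (\<integral>\<^sup>+h. ennreal (a k h r) \<partial>count_space UNIV) = 1"
    using AE_E3[OF a(2)] by metis
  \<comment> \<open>The weights are known to form a probability only off \<open>N\<close>; a
    constant point mass on the rest keeps \<open>L k\<close> Borel.\<close>
  define L where "L k r = (if r \<in> equivalences - N then embed_pmf (\<lambda>h. a k h r) else return_pmf 0)" for k r
  have pmf_L: "pmf (L k r) h = (if r \<in> equivalences - N then a k h r else indicator {h} 0)" for k r h
    using N(2,3)[of r] by (auto simp: L_def pmf_embed_pmf)
  have "L k \<in> borel_measurable equivalences_borel" for k
  proof (rule borel_measurable_pmfI)
    fix h
    have "equivalences - N \<in> sets equivalences_borel"
      using N(1) sets.compl_sets[of N equivalences_borel] by (auto simp: null_sets_def)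
    then have "(\<lambda>r. if r \<in> equivalences - N then a k h r else indicator {h} 0) \<in> borel_measurable equivalences_borel"
      using a(1)[of k h] by measurable
    then show "(\<lambda>r. pmf (L k r) h) \<in> borel_measurable equivalences_borel"
      unfolding pmf_L .
  qed
  moreover have "AE r in \<rho>. \<forall>g\<in>rel_class r 0.
      (\<lambda>k. dist (pmf_shift (- g) (L k r)) (L k (rel_shift (- g) r))) \<longlonglongrightarrow> 0"
  proof -
    have "AE r in \<rho>. r \<in> equivalences - N"
      using AE_not_in[OF N(1)] AE_space[of \<rho>] by eventually_elim auto
    \<comment> \<open>The estimate compares the kernels at \<open>r\<close> and at its translates,
      so the whole orbit has to avoid \<open>N\<close>; \<Gamma> being countable, it does so almost
      surely.\<close>
    then have "AE r in \<rho>. \<forall>g. rel_shift g r \<in> equivalences - N"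
      unfolding AE_all_countable by (intro allI AE_shift)
    with a(3) \<open>AE r in \<rho>. r \<in> equivalences - N\<close> show ?thesis
    proof eventually_elim
      case (elim r)
      show ?case
      proof
        fix g assume "g \<in> rel_class r 0"
        then have g: "r 0 g" by (simp add: rel_class_def)
        have "dist (pmf_shift (- g) (L k r)) (L k (rel_shift (- g) r)) \<le> \<delta> (- g) k" for k
        proof (rule dist_pmf_leI)
          fix S :: "'g set" assume "finite S"
          then show "(\<Sum>h\<in>S. \<bar>pmf (pmf_shift (- g) (L k r)) h - pmf (L k (rel_shift (- g) r)) h\<bar>) \<le> \<delta> (- g) k"
            using elim g unfolding pmf_pmf_shift pmf_L by simp
        qed
        then show "(\<lambda>k. dist (pmf_shift (- g) (L k r)) (L k (rel_shift (- g) r))) \<longlonglongrightarrow> 0"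
          by (intro tendsto_sandwich[OF _ _ tendsto_const \<delta>[of "- g"]]) auto
      qed
    qed
  qed
  ultimately show ?thesis
    using IRE unfolding amenable_IRE_def by blast
qed

end

section \<open>Choice of the filter for a weakly convergent sequence\<close>

theorem theorem1p2:
  fixes \<rho>s :: "nat \<Rightarrow> ('g::{group_add, countable} \<Rightarrow> 'g \<Rightarrow> bool) measure"
    and \<rho> :: "('g \<Rightarrow> 'g \<Rightarrow> bool) measure"
  assumes "exact_group TYPE('g) TYPE('x)"
    and "\<And>n. finite_IRE (\<rho>s n)"
    and "IRE \<rho>"
    and "converges_weakly \<rho>s \<rho>"
  shows "amenable_IRE \<rho>"
proof -
  have IREs: "IRE (\<rho>s n)" for n
    using assms(2) by (simp add: finite_IRE_def)
  \<comment> \<open>\<open>ex_filter_converging\<close> wants one bound for all indices, hence the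
    normalisation to 1; dividing by \<open>C\<close> below reduces every bounded function to this
    case.\<close>
  define good where "good = {f :: ('g \<Rightarrow> 'g \<Rightarrow> bool) \<Rightarrow> real. f \<in> borel_measurable equivalences_borel \<and> (\<forall>r. \<bar>f r\<bar> \<le> 1)}"
  have bound: "\<bar>if f \<in> good then \<integral>r. f r \<partial>\<rho>s n else 0\<bar> \<le> 1" for n f
  proof (cases "f \<in> good")
    case True
    interpret prob_space "\<rho>s n" using IREs[of n] by (simp add: IRE_def)
    have "sets (\<rho>s n) = sets equivalences_borel" using IREs[of n] by (simp add: IRE_def)
    with True have "f \<in> borel_measurable (\<rho>s n)"
      by (simp add: good_def cong: measurable_cong_sets)
    with True have "integrable (\<rho>s n) f"
      by (intro integrable_const_bound[of _ 1]) (auto simp: good_def)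
    then have "\<bar>\<integral>r. f r \<partial>\<rho>s n\<bar> \<le> (\<integral>r. \<bar>f r\<bar> \<partial>\<rho>s n)" "(\<integral>r. \<bar>f r\<bar> \<partial>\<rho>s n) \<le> 1"
      using True by (auto intro!: integral_abs_bound integral_le_const simp: good_def)
    then have "\<bar>\<integral>r. f r \<partial>\<rho>s n\<bar> \<le> 1" by (rule order_trans)
    then show ?thesis using True by simp
  qed simp
  \<comment> \<open>The index type consists of all real functions of a relation; those outside
    \<open>good\<close> get the value 0, which keeps the family bounded.\<close>
  obtain F where F: "F \<noteq> bot" "F \<le> sequentially"
    "\<And>f. \<exists>l. ((\<lambda>n. if f \<in> good then \<integral>r. f r \<partial>\<rho>s n else 0) \<longlongrightarrow> l) F"
    by (rule ex_filter_converging[of "\<lambda>n f. if f \<in> good then \<integral>r. f r \<partial>\<rho>s n else 0", OF bound]) (rule that)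
  interpret IRE_limit \<rho>s \<rho> F
  proof
    fix A :: "('g \<Rightarrow> 'g \<Rightarrow> bool) set" assume A: "A \<in> clopens"
    then have sub: "A \<subseteq> equivalences" by (rule clopens_sub)
    have "space \<rho> = equivalences" "space (\<rho>s n) = equivalences" for n
      using assms(3) IREs[of n] by (auto simp: IRE_def dest!: sets_eq_imp_space_eq)
    then have "(\<lambda>n. measure (\<rho>s n) A) \<longlonglongrightarrow> measure \<rho> A"
      using A assms(4)[unfolded converges_weakly_def, rule_format, of "indicat_real A"] sub
      by (simp add: clopens_def Int_absorb2)
    then show "((\<lambda>n. measure (\<rho>s n) A) \<longlongrightarrow> measure \<rho> A) F"
      by (rule tendsto_mono[OF F(2)])
  next
    fix f :: "('g \<Rightarrow> 'g \<Rightarrow> bool) \<Rightarrow> real" assume f: "bounded_borel f"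
    then obtain K where K: "\<And>r. \<bar>f r\<bar> \<le> K" by (auto simp: bounded_borel_def)
    define C where "C = \<bar>K\<bar> + 1"
    have C: "C > 0" by (simp add: C_def)
    have fC: "(\<lambda>r. f r / C) \<in> good"
    proof -
      have "\<bar>f r\<bar> \<le> C" for r using K[of r] by (simp add: C_def)
      then show ?thesis using f C by (auto simp: good_def bounded_borel_def abs_divide)
    qed
    then obtain l where "((\<lambda>n. \<integral>r. f r / C \<partial>\<rho>s n) \<longlongrightarrow> l) F"
      using F(3)[of "\<lambda>r. f r / C"] by auto
    from tendsto_mult_left[OF this, of C] have "((\<lambda>n. C * (\<integral>r. f r / C \<partial>\<rho>s n)) \<longlongrightarrow> C * l) F"
      .
    moreover have "C * (\<integral>r. f r / C \<partial>\<rho>s n) = (\<integral>r. f r \<partial>\<rho>s n)" for n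
      using C by simp
    ultimately have "((\<lambda>n. \<integral>r. f r \<partial>\<rho>s n) \<longlongrightarrow> C * l) F"
      by (simp only:)
    then show "\<exists>l. ((\<lambda>n. \<integral>r. f r \<partial>\<rho>s n) \<longlongrightarrow> l) F"
      by (rule exI)
  qed (use IREs assms(3) F(1) in auto)
  obtain q :: "nat \<Rightarrow> 'g \<Rightarrow> 'g pmf" and \<delta>
    where "\<And>k m. \<exists>S. finite S \<and> (\<forall>c. sum (pmf (q k c)) S > 1 - 1 / real (Suc m))"
    and "\<And>g k c. dist (pmf_shift g (q k c)) (q k (g + c)) \<le> \<delta> g k"
    and "\<And>g. \<delta> g \<longlonglongrightarrow> 0"
    by (rule exact_group_kernels[OF assms(1)]) (rule that)
  note q = this
  have fin: "AE r in \<rho>s n. \<forall>g. finite (rel_class r g)" for n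
    using assms(2) by (simp add: finite_IRE_def)
  show ?thesis by (rule amenable_limit[OF fin q])
qed

end
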